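(* The minimal displacement $m^R_t$ of the branching reflected Brownian motion started at the origin satisfies $$\lim_{t\to\infty}m^R_t=0\quad\text{almost surely}.$$
   Context: Branching reflected Brownian motion (quadratic, i.e. binary, branching): the system starts with a single particle at the origin, which moves on $[0,\infty)$ as a reflected Brownian motion with zero drift and unit variance (a process with the law of $|B|$, $B$ a standard linear Brownian motion). After an exponential time with parameter $1$ it splits into two particles, which from their common birth place move as independent reflected Brownian motions on $[0,\infty)$ and each branch at rate $1$ into two in the same way, and so on. Equivalently, it can be constructed by taking the absolute values of the positions of all particles of a binary branching Brownian motion (branching rate $1$) started at $0$. $N^R(t)$ is the set of particles alive at time $t$, $X^R_v(t)$ is the position of $v\in N^R(t)$ at time $t$, and $m^R_t:=\min_{v\in N^R(t)}X^R_v(t)$. *)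

theory Defs
  imports "HOL-Probability.Probability"
begin

text \<open>Standard linear Brownian motion on \<open>[0, \<infinity>)\<close>; \<open>B t \<omega>\<close> is unconstrained for \<open>t < 0\<close>.\<close>

definition (in prob_space) standard_brownian_motion :: "(real \<Rightarrow> 'a \<Rightarrow> real) \<Rightarrow> bool" where
  "standard_brownian_motion B \<longleftrightarrow>
     (\<forall>t\<ge>0. random_variable borel (B t)) \<and>
     (AE \<omega> in M. B 0 \<omega> = 0) \<and>
     (\<forall>s t. 0 \<le> s \<longrightarrow> s < t \<longrightarrow>
        distributed M lborel (\<lambda>\<omega>. B t \<omega> - B s \<omega>) (normal_density 0 (sqrt (t - s)))) \<and>
     (\<forall>(n::nat) t. 0 \<le> t 0 \<longrightarrow> mono_on {..n} t \<longrightarrow>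
        indep_vars (\<lambda>_. borel) (\<lambda>i \<omega>. B (t (Suc i)) \<omega> - B (t i) \<omega>) {..<n}) \<and>
     (AE \<omega> in M. continuous_on {0..} (\<lambda>t. B t \<omega>))"

text \<open>
  Particles carry binary Ulam--Harris labels with the most recent split first: \<open>[]\<close> is the
  initial particle, and \<open>v\<close> splits into \<open>True # v\<close> and \<open>False # v\<close>.
  The system is driven by lifetimes \<open>\<tau> v\<close> and Brownian motions \<open>B v\<close>, the latter run in the
  particle's own age.
\<close>

type_synonym particle = "bool list"

definition driving_path :: "(particle \<Rightarrow> real \<Rightarrow> 'a \<Rightarrow> real) \<Rightarrow> particle \<Rightarrow> 'a \<Rightarrow> real \<Rightarrow> real" where
  "driving_path B v \<omega> = (\<lambda>s\<in>{0..}. B v s \<omega>)"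

text \<open>
  The last assumption says that all the lifetimes and all the driving paths form one mutually
  independent family, the index \<open>Inl v\<close> standing for \<open>\<tau> v\<close> and \<open>Inr v\<close> for the path of \<open>B v\<close>.
\<close>

locale branching_reflected_brownian_motion = prob_space M
  for M :: "'a measure" +
  fixes \<tau> :: "particle \<Rightarrow> 'a \<Rightarrow> real"
    and B :: "particle \<Rightarrow> real \<Rightarrow> 'a \<Rightarrow> real"
  assumes lifetime: "distributed M lborel (\<tau> v) (exponential_density 1)"
    and motion: "standard_brownian_motion (B v)"
    and independent:
      "indep_sets (case_sum
         (\<lambda>v. sets (vimage_algebra (space M) (\<tau> v) borel))
         (\<lambda>v. sets (vimage_algebra (space M) (driving_path B v) (PiM {0..} (\<lambda>_. borel))))) UNIV"

primrec birth_time :: "(particle \<Rightarrow> 'a \<Rightarrow> real) \<Rightarrow> particle \<Rightarrow> 'a \<Rightarrow> real" where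
  "birth_time \<tau> [] \<omega> = 0"
| "birth_time \<tau> (c # v) \<omega> = birth_time \<tau> v \<omega> + \<tau> v \<omega>"

text \<open>Reflected Brownian motion started from \<open>x \<ge> 0\<close> is realised as \<open>\<bar>x + B s\<bar>\<close>.\<close>

primrec birth_place ::
  "(particle \<Rightarrow> 'a \<Rightarrow> real) \<Rightarrow> (particle \<Rightarrow> real \<Rightarrow> 'a \<Rightarrow> real) \<Rightarrow> particle \<Rightarrow> 'a \<Rightarrow> real" where
  "birth_place \<tau> B [] \<omega> = 0"
| "birth_place \<tau> B (c # v) \<omega> = \<bar>birth_place \<tau> B v \<omega> + B v (\<tau> v \<omega>) \<omega>\<bar>"

definition position ::
  "(particle \<Rightarrow> 'a \<Rightarrow> real) \<Rightarrow> (particle \<Rightarrow> real \<Rightarrow> 'a \<Rightarrow> real) \<Rightarrow> particle \<Rightarrow> real \<Rightarrow> 'a \<Rightarrow> real" where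
  "position \<tau> B v t \<omega> = \<bar>birth_place \<tau> B v \<omega> + B v (t - birth_time \<tau> v \<omega>) \<omega>\<bar>"

definition alive :: "(particle \<Rightarrow> 'a \<Rightarrow> real) \<Rightarrow> real \<Rightarrow> 'a \<Rightarrow> particle set" where
  "alive \<tau> t \<omega> = {v. birth_time \<tau> v \<omega> \<le> t \<and> t < birth_time \<tau> v \<omega> + \<tau> v \<omega>}"

text \<open>
  Almost surely \<open>alive \<tau> t \<omega>\<close> is finite and nonempty for every \<open>t \<ge> 0\<close>;
  off that event the value of \<open>Min\<close> is irrelevant.
\<close>

definition minimal_displacement ::
  "(particle \<Rightarrow> 'a \<Rightarrow> real) \<Rightarrow> (particle \<Rightarrow> real \<Rightarrow> 'a \<Rightarrow> real) \<Rightarrow> real \<Rightarrow> 'a \<Rightarrow> real" where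
  "minimal_displacement \<tau> B t \<omega> = Min ((\<lambda>v. position \<tau> B v t \<omega>) ` alive \<tau> t \<omega>)"

end

theory Submission
  imports Defs "HOL-Real_Asymp.Real_Asymp"
begin

text \<open>
  Generation \<open>n\<close> has exactly \<open>2 ^ n\<close> members, all but a small fraction of them born early and close
  to the origin, and the subtrees they found are independent. From each subtree one follows a
  single lineage: it is a reflected Brownian motion, so it is near the origin at time \<open>t\<close> with a
  probability of order \<open>t powr (- 1 / 2)\<close>. If \<open>2 ^ n\<close> is of order \<open>t\<^sup>2\<close>, all lineages fail simultaneously
  with a probability that is summable along the times \<open>sqrt k\<close>, whose gaps, at most \<open>1 / sqrt k\<close>, are
  so short that a particle hardly moves meanwhile. Borel--Cantelli concludes.

  Neither the law of a lineage nor a count of the good members of a generation is needed: both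
  estimates follow by induction from the decomposition at the first split. For the lineage, the
  Gaussian semigroup is a solution of the resulting renewal equation; for the whole tree, a failure
  probability bounded by \<open>z + (1 - z) * q\<close>, with \<open>z\<close> the chance that a member is bad, turns by
  convexity of the square into \<open>z + (1 - z) * q\<^sup>2\<close> one generation earlier.
\<close>

section \<open>Independence and evaluation of paths\<close>

text \<open>The population at a fixed time is random and entangled with its positions, whereas the
  two children of a particle use disjoint parts of the noise once the parent's noise is frozen;
  hence the cut by generations. Birth times and places within a generation are then random, and
  exponential moments control them at the cost of a factor 2 per split. With
  \<open>T = sqrt k\<close> the scales fit as follows. A member of generation about
  \<open>log 2 k\<close> has less than \<open>T / 2\<close> left, or lies beyond
  \<open>R = 6 * ln k\<close>, with probability at most
  \<open>k * (exp (- T / 4) + 2 * exp (- R / 2))\<close>; the 6 leaves \<open>2 / k ^ 2\<close> of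
  the second term. As the square of \<open>R\<close> divided by \<open>T\<close> tends to 0,
  starting points within \<open>R\<close> still see a Gaussian density of order
  \<open>k powr (- 1 / 4)\<close> near the origin, while moving a fixed distance within time
  \<open>1 / T\<close> has probability of order at most \<open>1 / k\<close>. Hitting events look
  only finitely many splits ahead, so that they are recursive; a term \<open>exp t / 2 ^ m\<close>
  pays for this truncation.\<close>

text \<open>
  Evaluation at a varying time is not measurable on the product space of all functions, so a path
  is read off from its values on the grids of mesh \<open>1 / Suc j\<close>; for continuous paths nothing changes.
\<close>

definition path_value :: "(real \<Rightarrow> real) \<Rightarrow> real \<Rightarrow> real" where
  "path_value f s = lim (\<lambda>j. f (real (nat \<lfloor>real (Suc j) * s\<rfloor>) / real (Suc j)))"

lemma measurable_path_value [measurable (raw)]: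
  assumes f: "f \<in> M \<rightarrow>\<^sub>M PiM {0..} (\<lambda>_. borel)" and g [measurable]: "g \<in> borel_measurable M"
  shows "(\<lambda>x. path_value (f x) (g x)) \<in> borel_measurable M"
proof -
  have "(\<lambda>x. f x (real (nat \<lfloor>real (Suc j) * g x\<rfloor>) / real (Suc j))) \<in> borel_measurable M" for j
  proof (rule measurable_compose_countable[where f = "\<lambda>i x. f x (real i / real (Suc j))"
        and g = "\<lambda>x. nat \<lfloor>real (Suc j) * g x\<rfloor>"])
    show "(\<lambda>x. f x (real i / real (Suc j))) \<in> borel_measurable M" for i
      using measurable_compose[OF f, of "\<lambda>h. h (real i / real (Suc j))" borel] by simp
    show "(\<lambda>x. nat \<lfloor>real (Suc j) * g x\<rfloor>) \<in> measurable M (count_space UNIV)"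
      by measurable
  qed
  then show ?thesis
    unfolding path_value_def by (rule borel_measurable_lim_metric)
qed

lemma floor_grid_tendsto:
  fixes s :: real
  assumes "0 \<le> s"
  shows "(\<lambda>j. real (nat \<lfloor>real (Suc j) * s\<rfloor>) / real (Suc j)) \<longlonglongrightarrow> s"
proof (rule tendsto_sandwich)
  show "\<forall>\<^sub>F j in sequentially. s - 1 / real (Suc j) \<le> real (nat \<lfloor>real (Suc j) * s\<rfloor>) / real (Suc j)"
  proof (intro always_eventually allI)
    fix j
    have "real (Suc j) * s - 1 \<le> real (nat \<lfloor>real (Suc j) * s\<rfloor>)"
      by linarith
    then have "(real (Suc j) * s - 1) / real (Suc j) \<le> real (nat \<lfloor>real (Suc j) * s\<rfloor>) / real (Suc j)"
      by (rule divide_right_mono) simp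
    then show "s - 1 / real (Suc j) \<le> real (nat \<lfloor>real (Suc j) * s\<rfloor>) / real (Suc j)"
      by (simp add: diff_divide_distrib)
  qed
  show "\<forall>\<^sub>F j in sequentially. real (nat \<lfloor>real (Suc j) * s\<rfloor>) / real (Suc j) \<le> s"
  proof (intro always_eventually allI)
    fix j
    have "real (nat \<lfloor>real (Suc j) * s\<rfloor>) \<le> real (Suc j) * s"
      using assms by simp
    then show "real (nat \<lfloor>real (Suc j) * s\<rfloor>) / real (Suc j) \<le> s"
      by (simp add: divide_le_eq mult.commute)
  qed
  have "(\<lambda>j. 1 / real (Suc j)) \<longlonglongrightarrow> 0"
    by (rule LIMSEQ_Suc[OF lim_1_over_n])
  from tendsto_diff[OF tendsto_const this] show "(\<lambda>j. s - 1 / real (Suc j)) \<longlonglongrightarrow> s"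
    by simp
qed simp

lemma path_value_eq:
  assumes "continuous_on {0..} f" "0 \<le> s"
  shows "path_value (\<lambda>r\<in>{0..}. f r) s = f s"
proof -
  have "(\<lambda>j. f (real (nat \<lfloor>real (Suc j) * s\<rfloor>) / real (Suc j))) \<longlonglongrightarrow> f s"
    using assms(2) by (intro continuous_on_tendsto_compose[OF assms(1) floor_grid_tendsto]) auto
  then show ?thesis
    unfolding path_value_def by (subst limI) auto
qed

lemma (in prob_space) pair_section_measurable:
  assumes "random_variable T Y"
    and "Measurable.pred (S \<Otimes>\<^sub>M T) (\<lambda>(a, b). Q a b)"
  shows "(\<lambda>a. prob {\<omega> \<in> space M. Q a (Y \<omega>)}) \<in> borel_measurable S"
proof -
  have [measurable]: "random_variable T Y" "Measurable.pred (S \<Otimes>\<^sub>M T) (\<lambda>(a, b). Q a b)"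
    using assms by auto
  have "Measurable.pred (S \<Otimes>\<^sub>M M) (\<lambda>p. Q (fst p) (Y (snd p)))"
    using measurable_compose[of "\<lambda>p. (fst p, Y (snd p))" "S \<Otimes>\<^sub>M M" "S \<Otimes>\<^sub>M T", OF _ assms(2)]
    by simp
  then show ?thesis by measurable
qed

text \<open>Fubini as a substitute for conditioning: \<open>X\<close> is frozen at a separate sample
  \<omega>' and only \<open>Y\<close> is averaged. The inductions over the tree use it with
  \<open>X\<close> the noise of the root of a subtree.\<close>

lemma (in prob_space) product_law_prob_eq:
  assumes X [measurable]: "random_variable S X" and Y [measurable]: "random_variable T Y"
    and ind: "distr M S X \<Otimes>\<^sub>M distr M T Y = distr M (S \<Otimes>\<^sub>M T) (\<lambda>x. (X x, Y x))"
    and Q: "Measurable.pred (S \<Otimes>\<^sub>M T) (\<lambda>(a, b). Q a b)"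
  shows "prob {\<omega> \<in> space M. Q (X \<omega>) (Y \<omega>)}
    = expectation (\<lambda>\<omega>'. prob {\<omega> \<in> space M. Q (X \<omega>') (Y \<omega>)})"
proof -
  interpret Y: prob_space "distr M T Y" by (rule prob_space_distr) simp
  define A where "A = {p \<in> space (S \<Otimes>\<^sub>M T). Q (fst p) (snd p)}"
  have A [measurable]: "A \<in> sets (S \<Otimes>\<^sub>M T)"
    using Q unfolding A_def pred_def by (simp add: case_prod_beta)
  have "emeasure M {\<omega> \<in> space M. Q (X \<omega>) (Y \<omega>)}
      = emeasure (distr M (S \<Otimes>\<^sub>M T) (\<lambda>x. (X x, Y x))) A"
    using A by (subst emeasure_distr)
      (auto simp: A_def space_pair_measure intro!: arg_cong[where f = "emeasure M"]
        measurable_space[OF X] measurable_space[OF Y])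
  also have "\<dots> = emeasure (distr M S X \<Otimes>\<^sub>M distr M T Y) A"
    by (simp add: ind)
  also have "\<dots> = (\<integral>\<^sup>+ x. emeasure (distr M T Y) (Pair x -` A) \<partial>distr M S X)"
    by (intro Y.emeasure_pair_measure_alt) simp
  also have "\<dots> = (\<integral>\<^sup>+ \<omega>'. emeasure (distr M T Y) (Pair (X \<omega>') -` A) \<partial>M)"
    by (subst nn_integral_distr) (auto intro: Y.measurable_emeasure_Pair)
  also have "\<dots> = (\<integral>\<^sup>+ \<omega>'. ennreal (prob {\<omega> \<in> space M. Q (X \<omega>') (Y \<omega>)}) \<partial>M)"
  proof (intro nn_integral_cong)
    fix \<omega>' assume "\<omega>' \<in> space M"
    then have "emeasure (distr M T Y) (Pair (X \<omega>') -` A) = emeasure M {\<omega> \<in> space M. Q (X \<omega>') (Y \<omega>)}"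
      using X Y sets_Pair1[OF A, of "X \<omega>'"] by (subst emeasure_distr)
        (auto simp: A_def space_pair_measure intro!: arg_cong[where f = "emeasure M"]
          measurable_space[OF X] measurable_space[OF Y])
    then show "emeasure (distr M T Y) (Pair (X \<omega>') -` A) = ennreal (prob {\<omega> \<in> space M. Q (X \<omega>') (Y \<omega>)})"
      by (simp add: emeasure_eq_measure)
  qed
  finally have "ennreal (prob {\<omega> \<in> space M. Q (X \<omega>) (Y \<omega>)}) = \<dots>"
    by (simp add: emeasure_eq_measure)
  moreover have "(\<lambda>\<omega>'. prob {\<omega> \<in> space M. Q (X \<omega>') (Y \<omega>)}) \<in> borel_measurable M"
    by (rule measurable_compose[OF X pair_section_measurable[OF Y Q]])
  then have "integrable M (\<lambda>\<omega>'. prob {\<omega> \<in> space M. Q (X \<omega>') (Y \<omega>)})"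
    by (intro integrable_const_bound[where B = 1]) auto
  ultimately show ?thesis
    by (subst (asm) nn_integral_eq_integral) (auto simp: integral_nonneg_AE)
qed

lemma (in prob_space) product_law_nn_integral_eq:
  assumes X [measurable]: "random_variable S X" and Y [measurable]: "random_variable T Y"
    and ind: "distr M S X \<Otimes>\<^sub>M distr M T Y = distr M (S \<Otimes>\<^sub>M T) (\<lambda>x. (X x, Y x))"
    and g: "(\<lambda>(a, b). g a b) \<in> borel_measurable (S \<Otimes>\<^sub>M T)"
  shows "(\<integral>\<^sup>+ \<omega>. g (X \<omega>) (Y \<omega>) \<partial>M) = (\<integral>\<^sup>+ \<omega>'. \<integral>\<^sup>+ \<omega>. g (X \<omega>') (Y \<omega>) \<partial>M \<partial>M)"
proof -
  interpret Y: prob_space "distr M T Y" by (rule prob_space_distr) simp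
  have g1: "g a \<in> borel_measurable T" if "a \<in> space S" for a
    using measurable_compose[OF measurable_Pair1'[OF that] g] by simp
  have "(\<integral>\<^sup>+ \<omega>. g (X \<omega>) (Y \<omega>) \<partial>M)
      = (\<integral>\<^sup>+ p. (\<lambda>(a, b). g a b) p \<partial>distr M (S \<Otimes>\<^sub>M T) (\<lambda>x. (X x, Y x)))"
    using g by (subst nn_integral_distr) auto
  also have "\<dots> = (\<integral>\<^sup>+ p. (\<lambda>(a, b). g a b) p \<partial>(distr M S X \<Otimes>\<^sub>M distr M T Y))"
    by (simp add: ind)
  also have "\<dots> = (\<integral>\<^sup>+ x. \<integral>\<^sup>+ y. g x y \<partial>distr M T Y \<partial>distr M S X)"
    using g by (subst Y.nn_integral_fst[symmetric]) (auto cong: measurable_cong_sets)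
  also have "\<dots> = (\<integral>\<^sup>+ \<omega>'. \<integral>\<^sup>+ y. g (X \<omega>') y \<partial>distr M T Y \<partial>M)"
  proof (rule nn_integral_distr[OF X])
    have "(\<lambda>(a, b). g a b) \<in> borel_measurable (S \<Otimes>\<^sub>M distr M T Y)"
      using g by (simp cong: measurable_cong_sets)
    then show "(\<lambda>x. \<integral>\<^sup>+ y. g x y \<partial>distr M T Y) \<in> borel_measurable (distr M S X)"
      by (simp add: Y.borel_measurable_nn_integral)
  qed
  also have "\<dots> = (\<integral>\<^sup>+ \<omega>'. \<integral>\<^sup>+ \<omega>. g (X \<omega>') (Y \<omega>) \<partial>M \<partial>M)"
    using X by (intro nn_integral_cong nn_integral_distr Y) (auto intro: g1 measurable_space[OF X])
  finally show ?thesis .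
qed

text \<open>Turns independence of generated sigma-algebras, the form given by the locale, into a
  product law: agreement on rectangles suffices.\<close>

lemma (in prob_space) indep_set_imp_product_law:
  assumes X [measurable]: "random_variable S X" and Y [measurable]: "random_variable T Y"
    and ind: "indep_set (sets (vimage_algebra (space M) X S)) (sets (vimage_algebra (space M) Y T))"
  shows "distr M S X \<Otimes>\<^sub>M distr M T Y = distr M (S \<Otimes>\<^sub>M T) (\<lambda>x. (X x, Y x))"
proof -
  interpret X: prob_space "distr M S X" by (rule prob_space_distr) simp
  interpret Y: prob_space "distr M T Y" by (rule prob_space_distr) simp
  show ?thesis
  proof (rule pair_measure_eqI)
    fix A C assume A: "A \<in> sets (distr M S X)" and C: "C \<in> sets (distr M T Y)"
    then have [measurable]: "A \<in> sets S" "C \<in> sets T" by auto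
    have "emeasure (distr M (S \<Otimes>\<^sub>M T) (\<lambda>x. (X x, Y x))) (A \<times> C)
        = emeasure M ((X -` A \<inter> space M) \<inter> (Y -` C \<inter> space M))"
      by (subst emeasure_distr) (auto intro!: arg_cong[where f = "emeasure M"])
    also have "\<dots> = prob (X -` A \<inter> space M) * prob (Y -` C \<inter> space M)"
      unfolding emeasure_eq_measure
      by (subst indep_setD[OF ind]) (auto simp: in_vimage_algebra)
    also have "\<dots> = emeasure (distr M S X) A * emeasure (distr M T Y) C"
      by (simp add: emeasure_distr emeasure_eq_measure ennreal_mult)
    finally show "emeasure (distr M S X) A * emeasure (distr M T Y) C
        = emeasure (distr M (S \<Otimes>\<^sub>M T) (\<lambda>x. (X x, Y x))) (A \<times> C)" by simp
  qed (auto cong: sets_pair_measure_cong intro: X.sigma_finite_measure_axioms Y.sigma_finite_measure_axioms)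
qed

abbreviation noise_space :: "(real \<times> (real \<Rightarrow> real)) measure" where
  "noise_space \<equiv> borel \<Otimes>\<^sub>M PiM {0..} (\<lambda>_. borel)"

definition noise ::
  "(particle \<Rightarrow> 'a \<Rightarrow> real) \<Rightarrow> (particle \<Rightarrow> real \<Rightarrow> 'a \<Rightarrow> real) \<Rightarrow> particle \<Rightarrow> 'a \<Rightarrow> real \<times> (real \<Rightarrow> real)" where
  "noise \<tau> B v \<omega> = (\<tau> v \<omega>, driving_path B v \<omega>)"

context branching_reflected_brownian_motion
begin

lemma measurable_lifetime [measurable]: "random_variable borel (\<tau> v)"
  using distributed_measurable[OF lifetime[of v]] by simp

lemma measurable_motion [measurable]: "0 \<le> s \<Longrightarrow> random_variable borel (B v s)"
  using motion[of v] by (simp add: standard_brownian_motion_def)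

lemma measurable_driving_path [measurable]:
  "driving_path B v \<in> M \<rightarrow>\<^sub>M PiM {0..} (\<lambda>_. borel)"
  unfolding driving_path_def by (intro measurable_restrict) auto

lemma measurable_noise [measurable]: "noise \<tau> B v \<in> M \<rightarrow>\<^sub>M noise_space"
  unfolding noise_def by measurable

text \<open>\<open>indep_set\<close> is a family indexed by \<open>bool\<close>, so the sum-indexed
  family is pulled back along the injection of \<open>bool\<close> onto \<open>Inl v\<close> and
  \<open>Inr v\<close>.\<close>

lemma indep_lifetime_path:
  "indep_set (sets (vimage_algebra (space M) (\<tau> v) borel))
     (sets (vimage_algebra (space M) (driving_path B v) (PiM {0..} (\<lambda>_. borel))))"
proof -
  let ?E = "case_sum (\<lambda>v. sets (vimage_algebra (space M) (\<tau> v) borel))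
         (\<lambda>v. sets (vimage_algebra (space M) (driving_path B v) (PiM {0..} (\<lambda>_. borel))))"
  have "indep_sets (\<lambda>b. ?E (case_bool (Inl v) (Inr v) b)) UNIV"
  proof (rule indep_setsI)
    show "?E (case_bool (Inl v) (Inr v) b) \<subseteq> events" for b :: bool
      using independent by (auto simp: indep_sets_def split: bool.split)
  next
    fix A J assume J: "J \<noteq> {}" "J \<subseteq> (UNIV :: bool set)" "finite J"
      "\<forall>j\<in>J. A j \<in> ?E (case_bool (Inl v) (Inr v) j)"
    let ?f = "case_bool (Inl v) (Inr v) :: bool \<Rightarrow> particle + particle"
    have inj: "inj ?f" by (auto simp: inj_def split: bool.split)
    have "prob (\<Inter>j\<in>?f ` J. A (the_inv ?f j)) = (\<Prod>j\<in>?f ` J. prob (A (the_inv ?f j)))"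
      using J by (intro indep_setsD[OF independent]) (auto simp: the_inv_f_f[OF inj])
    then show "prob (\<Inter>j\<in>J. A j) = (\<Prod>j\<in>J. prob (A j))"
      by (subst (asm) prod.reindex) (auto simp: the_inv_f_f[OF inj] intro: inj_on_subset[OF inj])
  qed
  then show ?thesis
    unfolding indep_set_def
    by (rule indep_sets_mono_sets) (auto split: bool.split)
qed

text \<open>Grouping: the index pairs of different particles are disjoint, so the sigma-algebras
  they generate are independent, and the noise of \<open>v\<close> is measurable for the one
  generated by its own pair.\<close>

lemma indep_noise: "indep_vars (\<lambda>_. noise_space) (noise \<tau> B) UNIV"
proof -
  let ?E = "case_sum (\<lambda>v. sets (vimage_algebra (space M) (\<tau> v) borel))
         (\<lambda>v. sets (vimage_algebra (space M) (driving_path B v) (PiM {0..} (\<lambda>_. borel))))"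
  let ?S = "\<lambda>v. sigma_sets (space M) (\<Union>i\<in>{Inl v, Inr v}. ?E i)"
  have "indep_sets ?S (UNIV :: particle set)"
  proof (rule indep_sets_collect_sigma)
    show "indep_sets ?E (\<Union>v\<in>UNIV. {Inl v, Inr v})"
      by (rule indep_sets_mono_index[OF _ independent]) auto
    show "disjoint_family (\<lambda>v. {Inl v, Inr v})"
      by (auto simp: disjoint_family_on_def)
    show "Int_stable (?E i)" for i
      by (auto split: sum.split simp: sets.Int_stable)
  qed
  then have "indep_sets (\<lambda>v. sigma_sets (space M) {noise \<tau> B v -` A \<inter> space M |A. A \<in> sets noise_space}) UNIV"
  proof (rule indep_sets_mono_sets)
    fix v :: particle
    let ?N = "sigma (space M) (\<Union>i\<in>{Inl v, Inr v}. ?E i)"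
    have sub: "(\<Union>i\<in>{Inl v, Inr v}. ?E i) \<subseteq> Pow (space M)"
      using sets.sets_into_space by fastforce
    have "\<tau> v \<in> ?N \<rightarrow>\<^sub>M borel"
      using sub by (auto simp: measurable_def sets_measure_of in_vimage_algebra)
    moreover have "driving_path B v \<in> ?N \<rightarrow>\<^sub>M PiM {0..} (\<lambda>_. borel)"
      using sub measurable_space[OF measurable_driving_path]
      by (auto simp: measurable_def sets_measure_of space_measure_of in_vimage_algebra)
    ultimately have "noise \<tau> B v \<in> ?N \<rightarrow>\<^sub>M noise_space"
      unfolding noise_def by measurable
    then have "noise \<tau> B v -` A \<inter> space M \<in> ?S v" if "A \<in> sets noise_space" for A
      using measurable_sets[OF _ that, of "noise \<tau> B v" ?N] sub by (simp add: sets_measure_of space_measure_of)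
    then show "sigma_sets (space M) {noise \<tau> B v -` A \<inter> space M |A. A \<in> sets noise_space} \<subseteq> ?S v"
      by (intro sigma_sets_mono) auto
  qed
  then show ?thesis
    unfolding indep_vars_def by auto
qed

end

section \<open>Hitting by a single particle\<close>

text \<open>A point of dyadic level \<open>Suc N\<close> is either of level \<open>N\<close> already
  or one step to the right of such a point. Walking down to 0 thus costs at most one increment per
  level, the costs form a geometric series, and continuity extends the bound beyond dyadic
  points.\<close>

lemma chaining_bound:
  fixes f :: "real \<Rightarrow> real"
  assumes h: "0 < h" and cont: "continuous_on {0..h} f" and \<eta>: "0 \<le> \<eta>" and r: "0 < r" "r < 1"
    and inc: "\<And>N i. i < 2 ^ N \<Longrightarrow> \<bar>f (h * real (Suc i) / 2 ^ N) - f (h * real i / 2 ^ N)\<bar> \<le> \<eta> * r ^ N"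
    and q: "0 \<le> q" "q \<le> h"
  shows "\<bar>f q - f 0\<bar> \<le> \<eta> / (1 - r)"
proof -
  have level: "\<bar>f (h * real i / 2 ^ N) - f 0\<bar> \<le> (\<Sum>j\<le>N. \<eta> * r ^ j)" if "i \<le> 2 ^ N" for i N
    using that
  proof (induction N arbitrary: i)
    case 0
    then consider "i = 0" | "i = 1" by force
    then show ?case using inc[of 0 0] \<eta> by cases auto
  next
    case (Suc N)
    have half: "h * real (2 * k) / 2 ^ Suc N = h * real k / 2 ^ N" for k
      by (simp add: field_simps)
    have pos: "0 \<le> \<eta> * r ^ Suc N"
      using \<eta> r by simp
    show ?case
    proof (cases "even i")
      case True
      then obtain k where k: "i = 2 * k" by (elim evenE)
      with Suc.prems Suc.IH[of k] pos show ?thesis unfolding k half by simp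
    next
      case False
      then obtain k where k: "i = Suc (2 * k)" by (elim oddE) auto
      have "\<bar>f (h * real i / 2 ^ Suc N) - f (h * real (2 * k) / 2 ^ Suc N)\<bar> \<le> \<eta> * r ^ Suc N"
        unfolding k using Suc.prems k by (intro inc) auto
      moreover have "\<bar>f (h * real (2 * k) / 2 ^ Suc N) - f 0\<bar> \<le> (\<Sum>j\<le>N. \<eta> * r ^ j)"
        unfolding half using Suc.prems k by (intro Suc.IH) auto
      ultimately show ?thesis by simp
    qed
  qed
  have geo: "(\<Sum>j\<le>N. \<eta> * r ^ j) \<le> \<eta> / (1 - r)" for N
  proof -
    have "(\<Sum>j\<le>N. r ^ j) \<le> (\<Sum>j. r ^ j)"
      using r by (intro sum_le_suminf) auto
    also have "\<dots> = 1 / (1 - r)" using r by (intro suminf_geometric) auto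
    finally show ?thesis
      using \<eta> by (simp add: sum_distrib_left[symmetric] mult_left_mono divide_inverse)
  qed
  \<comment> \<open>The index of the last dyadic point of level \<open>N\<close> not exceeding
    \<open>q\<close>; approaching \<open>q\<close> from the left keeps the points in
    \<open>{0..h}\<close>.\<close>
  define p where "p N = real (nat \<lfloor>q / h * 2 ^ N\<rfloor>)" for N :: nat
  have p_le: "p N \<le> q / h * 2 ^ N" and p_ge: "q / h * 2 ^ N - 1 \<le> p N" for N
  proof -
    have "0 \<le> q / h * 2 ^ N" using q h by simp
    then show "p N \<le> q / h * 2 ^ N" "q / h * 2 ^ N - 1 \<le> p N"
      unfolding p_def by linarith+
  qed
  have le2: "p N \<le> 2 ^ N" for N
  proof -
    have "q / h * 2 ^ N \<le> 1 * 2 ^ N" using q h by (intro mult_right_mono) auto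
    with p_le[of N] show ?thesis by simp
  qed
  have lim: "(\<lambda>N. h * p N / 2 ^ N) \<longlonglongrightarrow> q"
  proof (rule tendsto_sandwich)
    show "\<forall>\<^sub>F N in sequentially. q - h * (1 / 2) ^ N \<le> h * p N / 2 ^ N"
    proof (intro always_eventually allI)
      fix N :: nat
      have "h * (q / h * 2 ^ N - 1) / 2 ^ N \<le> h * p N / 2 ^ N"
        using h p_ge[of N] by (intro divide_right_mono mult_left_mono) auto
      then show "q - h * (1 / 2) ^ N \<le> h * p N / 2 ^ N"
        using h by (simp add: right_diff_distrib diff_divide_distrib power_one_over)
    qed
    show "\<forall>\<^sub>F N in sequentially. h * p N / 2 ^ N \<le> q"
    proof (intro always_eventually allI)
      fix N :: nat
      have "h * p N / 2 ^ N \<le> h * (q / h * 2 ^ N) / 2 ^ N"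
        using h p_le[of N] by (intro divide_right_mono mult_left_mono) auto
      then show "h * p N / 2 ^ N \<le> q" using h by simp
    qed
    have "(\<lambda>N. q - h * (1 / 2) ^ N) \<longlonglongrightarrow> q - h * 0"
      by (intro tendsto_intros LIMSEQ_power_zero) auto
    then show "(\<lambda>N. q - h * (1 / 2) ^ N) \<longlonglongrightarrow> q" by simp
  qed simp
  have "h * p N / 2 ^ N \<in> {0..h}" for N
    using le2[of N] h unfolding p_def by (auto simp: divide_le_eq)
  then have "(\<lambda>N. f (h * p N / 2 ^ N)) \<longlonglongrightarrow> f q"
    using q by (intro continuous_on_tendsto_compose[OF cont lim]) auto
  then have "(\<lambda>N. \<bar>f (h * p N / 2 ^ N) - f 0\<bar>) \<longlonglongrightarrow> \<bar>f q - f 0\<bar>"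
    by (intro tendsto_intros)
  moreover have "\<bar>f (h * p N / 2 ^ N) - f 0\<bar> \<le> \<eta> / (1 - r)" for N
  proof -
    have "nat \<lfloor>q / h * 2 ^ N\<rfloor> \<le> 2 ^ N"
      using le2[of N] unfolding p_def by (metis of_nat_le_iff of_nat_numeral of_nat_power)
    from level[OF this] geo[of N] show ?thesis unfolding p_def by linarith
  qed
  ultimately show ?thesis by (intro LIMSEQ_le_const2) auto
qed

text \<open>Markov's inequality for the fourth power. Second moments are too weak for chaining:
  level \<open>N\<close> has \<open>2 ^ N\<close> increments of variance \<open>h / 2 ^ N\<close>,
  and their union bound would not decay in \<open>N\<close>.\<close>

lemma (in prob_space) normal_tail_fourth_moment:
  assumes X: "distributed M lborel X (normal_density 0 \<sigma>)" and "0 < \<sigma>" "0 < a"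
  shows "prob {\<omega> \<in> space M. a \<le> \<bar>X \<omega>\<bar>} \<le> 3 * \<sigma> ^ 4 / a ^ 4"
proof -
  have [measurable]: "random_variable borel X"
    using distributed_measurable[OF X] by simp
  have m: "has_bochner_integral lborel (\<lambda>x. normal_density 0 \<sigma> x * x ^ 4) (3 * \<sigma> ^ 4)"
    using normal_moment_even[OF \<open>0 < \<sigma>\<close>, of 0 2] \<open>0 < \<sigma>\<close>
    by (simp add: fact_numeral power_divide field_simps flip: power_mult)
  have "integrable M (\<lambda>\<omega>. X \<omega> ^ 4)"
    using m distributed_integrable[OF X, of "\<lambda>x. x ^ 4"] by (auto simp: has_bochner_integral_iff)
  moreover have "expectation (\<lambda>\<omega>. X \<omega> ^ 4) = 3 * \<sigma> ^ 4"
    using m distributed_integral[OF X, of "\<lambda>x. x ^ 4"] by (auto simp: has_bochner_integral_iff)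
  ultimately have "prob {\<omega> \<in> space M. a ^ 4 \<le> X \<omega> ^ 4} \<le> 3 * \<sigma> ^ 4 / a ^ 4"
    using integral_Markov_inequality_measure[of M "\<lambda>\<omega>. X \<omega> ^ 4" "{}" "a ^ 4"] \<open>0 < a\<close> by simp
  moreover have "a ^ 4 \<le> X \<omega> ^ 4 \<longleftrightarrow> a \<le> \<bar>X \<omega>\<bar>" for \<omega>
    using power_mono_iff[of a "\<bar>X \<omega>\<bar>" 4] \<open>0 < a\<close> by (simp add: power_even_abs_numeral)
  ultimately show ?thesis by simp
qed

definition displacement :: "real \<times> (real \<Rightarrow> real) \<Rightarrow> real" where
  "displacement z = path_value (snd z) (fst z)"

lemma measurable_displacement [measurable]: "displacement \<in> borel_measurable noise_space"
  unfolding displacement_def by measurable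

text \<open>
  The particle, of which the current age is \<open>t\<close> and the birth place \<open>x\<close>, survives the next \<open>h\<close> units of time
  and stays within \<open>e\<close> of the origin throughout. Rational times keep the event measurable.
\<close>

definition hit :: "real \<Rightarrow> real \<Rightarrow> real \<Rightarrow> real \<Rightarrow> real \<times> (real \<Rightarrow> real) \<Rightarrow> bool" where
  "hit h e t x z \<longleftrightarrow> 0 \<le> t \<and> t + h < fst z \<and>
     (\<forall>q. real_of_rat q \<in> {0..h} \<longrightarrow> \<bar>x + path_value (snd z) (t + real_of_rat q)\<bar> \<le> e)"

lemma measurable_hit [measurable (raw)]:
  assumes [measurable]: "t \<in> borel_measurable N" "x \<in> borel_measurable N" "z \<in> N \<rightarrow>\<^sub>M noise_space"
  shows "Measurable.pred N (\<lambda>w. hit h e (t w) (x w) (z w))"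
  unfolding hit_def by measurable

text \<open>
  The chance that a Brownian motion from \<open>x\<close> is in \<open>{-a..a}\<close> at time \<open>t\<close>; meaningful for \<open>t > 0\<close> only.
\<close>

definition heat :: "real \<Rightarrow> real \<Rightarrow> real \<Rightarrow> real" where
  "heat a t x = (\<integral>y. normal_density 0 (sqrt t) y * indicator {-a..a} (x + y) \<partial>lborel)"

lemma integrable_heat:
  "0 < t \<Longrightarrow> integrable lborel (\<lambda>y. normal_density 0 (sqrt t) y * indicator {-a..a} (x + y))"
  by (rule Bochner_Integration.integrable_bound[OF integrable_normal_density[of "sqrt t" 0]])
     (auto split: split_indicator)

lemma ennreal_heat:
  "0 < t \<Longrightarrow> ennreal (heat a t x)
     = (\<integral>\<^sup>+y. ennreal (normal_density 0 (sqrt t) y) * indicator {-a..a} (x + y) \<partial>lborel)"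
  unfolding heat_def
  by (subst nn_integral_eq_integral[OF integrable_heat, symmetric])
     (auto intro!: nn_integral_cong split: split_indicator)

context branching_reflected_brownian_motion
begin

lemma AE_lifetime_pos: "AE \<omega> in M. 0 < \<tau> v \<omega>"
proof -
  have "prob {\<omega> \<in> space M. \<tau> v \<omega> \<le> 0} = 0"
    using exponential_distributedD_le[OF lifetime[of v], of 0] by simp
  then show ?thesis by (subst (asm) prob_eq_0) (auto simp: not_le)
qed

lemma AE_motion_continuous: "AE \<omega> in M. continuous_on {0..} (\<lambda>t. B v t \<omega>)"
  and AE_motion_0: "AE \<omega> in M. B v 0 \<omega> = 0"
  using motion[of v] by (simp_all add: standard_brownian_motion_def)

lemma motion_increment:
  "0 \<le> s \<Longrightarrow> s < t \<Longrightarrow> distributed M lborel (\<lambda>\<omega>. B v t \<omega> - B v s \<omega>) (normal_density 0 (sqrt (t - s)))"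
  using motion[of v] by (simp add: standard_brownian_motion_def)

text \<open>\<open>standard_brownian_motion\<close> prescribes laws of increments, so the value at
  \<open>s\<close> is treated as the increment from time 0, where the path vanishes almost
  surely.\<close>

lemma nn_integral_motion:
  assumes "0 < s" and [measurable]: "g \<in> borel_measurable borel"
  shows "(\<integral>\<^sup>+\<omega>. g (path_value (driving_path B v \<omega>) s) \<partial>M)
    = (\<integral>\<^sup>+y. ennreal (normal_density 0 (sqrt s) y) * g y \<partial>lborel)"
proof -
  have "(\<integral>\<^sup>+\<omega>. g (path_value (driving_path B v \<omega>) s) \<partial>M) = (\<integral>\<^sup>+\<omega>. g (B v s \<omega> - B v 0 \<omega>) \<partial>M)"
    using AE_motion_continuous[of v] AE_motion_0[of v]
    by (intro nn_integral_cong_AE, eventually_elim)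
      (use \<open>0 < s\<close> in \<open>simp add: driving_path_def path_value_eq\<close>)
  also have "\<dots> = (\<integral>\<^sup>+y. ennreal (normal_density 0 (sqrt s) y) * g y \<partial>lborel)"
    using motion_increment[of 0 s v] assms
    by (intro distributed_nn_integral[symmetric]) auto
  finally show ?thesis .
qed

text \<open>The lifetime is independent of the path, so it can be frozen; the displacement is then
  the path at a fixed time, a centred Gaussian with variance \<open>s\<close>.\<close>

lemma one_step_law:
  assumes g [measurable]: "(\<lambda>(s, y). g s y) \<in> borel_measurable (borel \<Otimes>\<^sub>M borel)"
  shows "(\<integral>\<^sup>+\<omega>. g (\<tau> v \<omega>) (displacement (noise \<tau> B v \<omega>)) \<partial>M)
    = (\<integral>\<^sup>+s. ennreal (exponential_density 1 s) *
        (\<integral>\<^sup>+y. ennreal (normal_density 0 (sqrt s) y) * g s y \<partial>lborel) \<partial>lborel)"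
proof -
  have [measurable]: "(\<lambda>p. g (fst p) (snd p)) \<in> borel_measurable (borel \<Otimes>\<^sub>M borel)"
    using g by (simp add: case_prod_beta)
  have g1: "g s \<in> borel_measurable borel" for s
    using measurable_compose[OF measurable_Pair1' g, of s] by simp
  have "(\<integral>\<^sup>+\<omega>. g (\<tau> v \<omega>) (displacement (noise \<tau> B v \<omega>)) \<partial>M)
      = (\<integral>\<^sup>+\<omega>. g (\<tau> v \<omega>) (path_value (driving_path B v \<omega>) (\<tau> v \<omega>)) \<partial>M)"
    by (simp add: displacement_def noise_def)
  also have "\<dots> = (\<integral>\<^sup>+\<omega>'. \<integral>\<^sup>+\<omega>. g (\<tau> v \<omega>') (path_value (driving_path B v \<omega>) (\<tau> v \<omega>')) \<partial>M \<partial>M)"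
  proof (rule product_law_nn_integral_eq[where g = "\<lambda>s p. g s (path_value p s)"])
    show "distr M borel (\<tau> v) \<Otimes>\<^sub>M distr M (Pi\<^sub>M {0..} (\<lambda>_. borel)) (driving_path B v)
        = distr M (borel \<Otimes>\<^sub>M Pi\<^sub>M {0..} (\<lambda>_. borel)) (\<lambda>x. (\<tau> v x, driving_path B v x))"
      by (intro indep_set_imp_product_law indep_lifetime_path) auto
    show "(\<lambda>(s, p). g s (path_value p s)) \<in> borel_measurable (borel \<Otimes>\<^sub>M Pi\<^sub>M {0..} (\<lambda>_. borel))"
      using measurable_compose[of "\<lambda>p. (fst p, path_value (snd p) (fst p))"
          "borel \<Otimes>\<^sub>M Pi\<^sub>M {0..} (\<lambda>_. borel)", OF _ g]
      by (simp add: case_prod_beta)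
  qed auto
  also have "\<dots> = (\<integral>\<^sup>+\<omega>'. (\<integral>\<^sup>+y. ennreal (normal_density 0 (sqrt (\<tau> v \<omega>')) y) * g (\<tau> v \<omega>') y \<partial>lborel) \<partial>M)"
    using AE_lifetime_pos[of v]
    by (intro nn_integral_cong_AE, eventually_elim) (simp add: nn_integral_motion g1)
  also have "\<dots> = (\<integral>\<^sup>+s. ennreal (exponential_density 1 s) *
        (\<integral>\<^sup>+y. ennreal (normal_density 0 (sqrt s) y) * g s y \<partial>lborel) \<partial>lborel)"
  proof (intro distributed_nn_integral[OF lifetime, symmetric])
    show "(\<lambda>s. \<integral>\<^sup>+y. ennreal (normal_density 0 (sqrt s) y) * g s y \<partial>lborel) \<in> borel_measurable lborel"
      unfolding normal_density_def by measurable
  qed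
  finally show ?thesis .
qed

text \<open>
  Chaining over the dyadic levels \<open>N\<close> with thresholds \<open>\<eta> * (9 / 10) ^ N\<close>, which sum to \<open>10 * \<eta> = a\<close>. The
  fourth moment bounds the failure at level \<open>N\<close> by \<open>3 * h\<^sup>2 / \<eta> ^ 4 * (4 / 5) ^ N\<close>, hence the constant
  \<open>150000 = 3 * 5 * 10 ^ 4\<close>.
\<close>

lemma oscillation:
  assumes t: "0 \<le> t" and h: "0 < h" and a: "0 < a"
  obtains E where "E \<in> events" "prob E \<le> 150000 * h\<^sup>2 / a ^ 4"
    "\<And>\<omega> q. \<omega> \<in> space M - E \<Longrightarrow> continuous_on {0..} (\<lambda>s. B v s \<omega>) \<Longrightarrow> 0 \<le> q \<Longrightarrow> q \<le> h \<Longrightarrow>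
        \<bar>B v (t + q) \<omega> - B v t \<omega>\<bar> \<le> a"
proof -
  define \<eta> where "\<eta> = a / 10"
  define X where "X N i \<omega> = B v (t + h * real (Suc i) / 2 ^ N) \<omega> - B v (t + h * real i / 2 ^ N) \<omega>" for N i \<omega>
  have \<eta>: "0 < \<eta>" using a by (simp add: \<eta>_def)
  have [measurable]: "random_variable borel (X N i)" for N i
    unfolding X_def using t h by (intro borel_measurable_diff measurable_motion) auto
  define A where "A N i = {\<omega> \<in> space M. \<eta> * (9/10) ^ N \<le> \<bar>X N i \<omega>\<bar>}" for N i
  have [measurable]: "A N i \<in> events" for N i unfolding A_def by measurable
  define E where "E = (\<Union>N. \<Union>i<2 ^ N. A N i)"
  have single: "prob (A N i) \<le> 3 * h\<^sup>2 / \<eta> ^ 4 * (4/5) ^ N / 2 ^ N" for N i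
  proof -
    have "distributed M lborel (X N i) (normal_density 0 (sqrt (h / 2 ^ N)))"
      using motion_increment[of "t + h * real i / 2 ^ N" "t + h * real (Suc i) / 2 ^ N" v] t h
      by (simp add: X_def[abs_def] field_simps)
    from normal_tail_fourth_moment[OF this, of "\<eta> * (9/10) ^ N"]
    have "prob (A N i) \<le> 3 * (sqrt (h / 2 ^ N)) ^ 4 / (\<eta> * (9/10) ^ N) ^ 4"
      using h \<eta> by (simp add: A_def)
    also have "(sqrt (h / 2 ^ N)) ^ 4 = (h / 2 ^ N)\<^sup>2"
    proof -
      have "(sqrt (h / 2 ^ N)) ^ 4 = ((sqrt (h / 2 ^ N))\<^sup>2)\<^sup>2" by (simp flip: power_mult)
      then show ?thesis using h by simp
    qed
    \<comment> \<open>\<open>5000 / 6561\<close> is \<open>(1 / 2) / (9 / 10) ^ 4\<close>. The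
      separate factor \<open>1 / 2 ^ N\<close> is kept to cancel the number of increments in the
      union bound.\<close>
    also have "3 * (h / 2 ^ N)\<^sup>2 / (\<eta> * (9/10) ^ N) ^ 4
        = 3 * h\<^sup>2 / \<eta> ^ 4 * ((5000/6561) ^ N / 2 ^ N)"
    proof -
      have "((9/10 :: real) ^ N) ^ 4 = (6561/10000) ^ N"
        by (simp add: power_commutes flip: power_mult) (simp add: power_mult mult.commute[of N] power_divide)
      moreover have "((2::real) ^ N)\<^sup>2 = 2 ^ N * 2 ^ N" by (simp add: power2_eq_square)
      moreover have "(5000/6561 :: real) ^ N = 1 / (6561/10000) ^ N / 2 ^ N"
      proof -
        have "(5000/6561 :: real) ^ N * ((6561/10000) ^ N * 2 ^ N) = ((5000/6561) * (6561/10000 * 2)) ^ N"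
          by (simp only: power_mult_distrib)
        then show ?thesis by (simp add: field_simps)
      qed
      ultimately show ?thesis
        unfolding power_mult_distrib[of \<eta>] power_divide[of h] by simp
    qed
    also have "\<dots> \<le> 3 * h\<^sup>2 / \<eta> ^ 4 * ((4/5) ^ N / 2 ^ N)"
      using \<eta> by (intro mult_left_mono divide_right_mono power_mono) auto
    finally show ?thesis by simp
  qed
  have level: "prob (\<Union>i<2 ^ N. A N i) \<le> 3 * h\<^sup>2 / \<eta> ^ 4 * (4/5) ^ N" for N
  proof -
    have "prob (\<Union>i<2 ^ N. A N i) \<le> (\<Sum>i<2 ^ N. prob (A N i))"
      by (intro finite_measure_subadditive_finite) auto
    also have "\<dots> \<le> (\<Sum>i<(2::nat) ^ N. 3 * h\<^sup>2 / \<eta> ^ 4 * (4/5) ^ N / 2 ^ N)"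
      by (intro sum_mono single)
    finally show ?thesis by simp
  qed
  have geo: "summable (\<lambda>N. 3 * h\<^sup>2 / \<eta> ^ 4 * (4/5::real) ^ N)"
    by (intro summable_mult summable_geometric) auto
  have summ: "summable (\<lambda>N. prob (\<Union>i<2 ^ N. A N i))"
    by (rule summable_comparison_test'[OF geo]) (use level in auto)
  have "prob E \<le> (\<Sum>N. prob (\<Union>i<2 ^ N. A N i))"
    unfolding E_def using summ by (intro finite_measure_subadditive_countably) auto
  also have "\<dots> \<le> (\<Sum>N. 3 * h\<^sup>2 / \<eta> ^ 4 * (4/5) ^ N)"
    by (rule suminf_le[OF level summ geo])
  also have "\<dots> = 3 * h\<^sup>2 / \<eta> ^ 4 * 5"
    by (subst suminf_mult) (auto simp: suminf_geometric)
  also have "\<dots> = 150000 * h\<^sup>2 / a ^ 4"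
    by (simp add: \<eta>_def power_divide)
  finally have "prob E \<le> 150000 * h\<^sup>2 / a ^ 4" .
  moreover have "E \<in> events" unfolding E_def by measurable
  moreover have "\<bar>B v (t + q) \<omega> - B v t \<omega>\<bar> \<le> a"
    if \<omega>: "\<omega> \<in> space M - E" and c: "continuous_on {0..} (\<lambda>s. B v s \<omega>)" and q: "0 \<le> q" "q \<le> h" for \<omega> q
  proof -
    have "\<bar>B v (t + q) \<omega> - B v (t + 0) \<omega>\<bar> \<le> \<eta> / (1 - 9/10)"
    proof (rule chaining_bound[where f = "\<lambda>q. B v (t + q) \<omega>" and h = h])
      show "continuous_on {0..h} (\<lambda>q. B v (t + q) \<omega>)"
        using t by (intro continuous_on_compose2[OF c] continuous_intros) auto
      fix N i :: nat assume "i < 2 ^ N"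
      with \<omega> show "\<bar>B v (t + h * real (Suc i) / 2 ^ N) \<omega> - B v (t + h * real i / 2 ^ N) \<omega>\<bar> \<le> \<eta> * (9/10) ^ N"
        by (auto simp: E_def A_def X_def not_le less_imp_le)
    qed (use \<eta> h q in auto)
    then show ?thesis by (simp add: \<eta>_def)
  qed
  ultimately show thesis using that by blast
qed

text \<open>Being within \<open>a\<close> at age \<open>t\<close> and oscillating by at most
  \<open>a\<close> afterwards keeps the particle within \<open>2 * a\<close>. Survival up to age
  \<open>t + h\<close> is independent of the path and supplies the exponential factor.\<close>

lemma prob_hit_ge:
  assumes t: "0 < t" and h: "0 < h" and a: "0 < a"
  shows "exp (- (t + h)) * (heat a t x - 150000 * h\<^sup>2 / a ^ 4)
    \<le> prob {\<omega> \<in> space M. hit h (2 * a) t x (noise \<tau> B v \<omega>)}"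
proof -
  define good where "good p \<longleftrightarrow> (\<forall>q. real_of_rat q \<in> {0..h} \<longrightarrow> \<bar>x + path_value p (t + real_of_rat q)\<bar> \<le> 2 * a)"
    for p :: "real \<Rightarrow> real"
  have [measurable]: "Measurable.pred (PiM {0..} (\<lambda>_. borel)) good"
    unfolding good_def by measurable
  let ?P = "driving_path B v" and ?W = "Pi\<^sub>M {0::real..} (\<lambda>_. borel :: real measure)"
  obtain E where E: "E \<in> events" "prob E \<le> 150000 * h\<^sup>2 / a ^ 4"
    and osc: "\<And>\<omega> q. \<omega> \<in> space M - E \<Longrightarrow> continuous_on {0..} (\<lambda>s. B v s \<omega>) \<Longrightarrow> 0 \<le> q \<Longrightarrow> q \<le> h \<Longrightarrow>
        \<bar>B v (t + q) \<omega> - B v t \<omega>\<bar> \<le> a"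
    using oscillation[of t h a v] t h a by (metis less_imp_le)
  have "ennreal (heat a t x) = (\<integral>\<^sup>+\<omega>. indicator {-a..a} (x + path_value (?P \<omega>) t) \<partial>M)"
    using t nn_integral_motion[of t "\<lambda>y. indicator {-a..a} (x + y)" v] by (simp add: ennreal_heat)
  also have "\<dots> = (\<integral>\<^sup>+\<omega>. indicator {\<omega> \<in> space M. x + path_value (?P \<omega>) t \<in> {-a..a}} \<omega> \<partial>M)"
    by (intro nn_integral_cong) (auto split: split_indicator)
  also have "\<dots> = ennreal (prob {\<omega> \<in> space M. x + path_value (?P \<omega>) t \<in> {-a..a}})"
    by (subst nn_integral_indicator) (auto simp: emeasure_eq_measure)
  finally have "heat a t x = prob {\<omega> \<in> space M. x + path_value (?P \<omega>) t \<in> {-a..a}}"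
    by (simp add: heat_def integral_nonneg_AE)
  also have "\<dots> \<le> prob ({\<omega> \<in> space M. good (?P \<omega>)} \<union> E)"
  proof (rule finite_measure_mono_AE)
    show "AE \<omega> in M. \<omega> \<in> {\<omega> \<in> space M. x + path_value (?P \<omega>) t \<in> {-a..a}}
        \<longrightarrow> \<omega> \<in> {\<omega> \<in> space M. good (?P \<omega>)} \<union> E"
      using AE_motion_continuous[of v]
    proof eventually_elim
      case (elim \<omega>)
      have eq: "path_value (?P \<omega>) (t + q) = B v (t + q) \<omega>" if "0 \<le> q" for q
        unfolding driving_path_def using elim t that by (intro path_value_eq) auto
      show ?case
      proof (intro impI UnCI)
        assume \<omega>: "\<omega> \<in> {\<omega> \<in> space M. x + path_value (?P \<omega>) t \<in> {-a..a}}" "\<omega> \<notin> E"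
        then have "\<bar>x + B v t \<omega>\<bar> \<le> a" using eq[of 0] by auto
        then have "\<bar>x + path_value (?P \<omega>) (t + q)\<bar> \<le> 2 * a" if "0 \<le> q" "q \<le> h" for q
          using osc[OF _ elim that] \<omega> eq[OF that(1)] by auto
        then have "good (?P \<omega>)" unfolding good_def by auto
        then show "\<omega> \<in> {\<omega> \<in> space M. good (?P \<omega>)}" using \<omega> by simp
      qed
    qed
  qed (use E in auto)
  also have "\<dots> \<le> prob {\<omega> \<in> space M. good (?P \<omega>)} + prob E"
    using E by (intro measure_Un_le) auto
  finally have good: "heat a t x - 150000 * h\<^sup>2 / a ^ 4 \<le> prob {\<omega> \<in> space M. good (?P \<omega>)}"
    using E by simp
  have "exp (- (t + h)) = prob {\<omega> \<in> space M. t + h < \<tau> v \<omega>}"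
    using exponential_distributedD_gt[OF lifetime[of v], of "t + h"] t h by simp
  with good have "exp (- (t + h)) * (heat a t x - 150000 * h\<^sup>2 / a ^ 4)
      \<le> prob {\<omega> \<in> space M. t + h < \<tau> v \<omega>} * prob {\<omega> \<in> space M. good (?P \<omega>)}"
    by (simp add: mult_left_mono)
  also have "\<dots> = prob ({\<omega> \<in> space M. t + h < \<tau> v \<omega>} \<inter> {\<omega> \<in> space M. good (?P \<omega>)})"
  proof (rule indep_setD[OF indep_lifetime_path, symmetric])
    have "\<tau> v -` {t + h<..} \<inter> space M \<in> sets (vimage_algebra (space M) (\<tau> v) borel)"
      by (rule in_vimage_algebra) simp
    also have "\<tau> v -` {t + h<..} \<inter> space M = {\<omega> \<in> space M. t + h < \<tau> v \<omega>}" by auto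
    finally show "{\<omega> \<in> space M. t + h < \<tau> v \<omega>} \<in> sets (vimage_algebra (space M) (\<tau> v) borel)" .
    have "?P -` {p \<in> space ?W. good p} \<inter> space M \<in> sets (vimage_algebra (space M) ?P ?W)"
      by (rule in_vimage_algebra) simp
    also have "?P -` {p \<in> space ?W. good p} \<inter> space M = {\<omega> \<in> space M. good (?P \<omega>)}"
      using measurable_space[OF measurable_driving_path[of v]] by auto
    finally show "{\<omega> \<in> space M. good (?P \<omega>)} \<in> sets (vimage_algebra (space M) ?P ?W)" .
  qed
  also have "\<dots> = prob {\<omega> \<in> space M. hit h (2 * a) t x (noise \<tau> B v \<omega>)}"
    using t by (intro arg_cong[where f = prob]) (auto simp: hit_def good_def noise_def)
  finally show ?thesis .
qed

end

section \<open>Lineages\<close>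

lemma heat_even: "heat a t (- x) = heat a t x"
proof -
  have "heat a t (- x) = (\<integral>y. normal_density 0 (sqrt t) (- y) * indicator {-a..a} (- x - y) \<partial>lborel)"
    unfolding heat_def
    by (subst lborel_integral_real_affine[of "-1" _ 0]) simp_all
  also have "\<dots> = heat a t x"
    unfolding heat_def by (intro Bochner_Integration.integral_cong)
      (auto simp: normal_density_def split: split_indicator)
  finally show ?thesis .
qed

text \<open>The target interval is symmetric, so the absolute value taken at each split is invisible
  to \<open>heat\<close>. This lets the free Gaussian semigroup serve for the reflected
  motion.\<close>

lemma heat_abs: "heat a t \<bar>x\<bar> = heat a t x"
  by (cases "0 \<le> x") (auto simp: heat_even)

lemma ennreal_heat_translate:
  assumes "0 < t"
  shows "ennreal (heat a t x)
     = (\<integral>\<^sup>+u. ennreal (normal_density 0 (sqrt t) (u - x)) * indicator {-a..a} u \<partial>lborel)"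
  unfolding ennreal_heat[OF assms]
  by (subst nn_integral_real_affine[of _ 1 "-x"]) (auto simp: algebra_simps)

lemma heat_nonneg: "0 \<le> heat a t x"
  unfolding heat_def by (intro integral_nonneg_AE) auto

lemma heat_le_1:
  assumes "0 < t"
  shows "heat a t x \<le> 1"
proof -
  have "heat a t x \<le> (\<integral>y. normal_density 0 (sqrt t) y \<partial>lborel)"
    unfolding heat_def using assms
    by (intro integral_mono integrable_heat) (auto split: split_indicator)
  then show ?thesis using assms by simp
qed

lemma measurable_heat [measurable (raw)]:
  assumes [measurable]: "f \<in> borel_measurable N" "g \<in> borel_measurable N"
  shows "(\<lambda>w. heat a (f w) (g w)) \<in> borel_measurable N"
  unfolding heat_def normal_density_def by measurable

text \<open>Chapman-Kolmogorov: with the intermediate point integrated first, the two Gaussian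
  densities convolve to the one with variance \<open>t\<close>.\<close>

lemma heat_semigroup:
  assumes "0 < s" "s < t"
  shows "(\<integral>\<^sup>+y. ennreal (normal_density 0 (sqrt s) y) * ennreal (heat a (t - s) (x + y)) \<partial>lborel)
    = ennreal (heat a t x)"
proof -
  have "(\<integral>\<^sup>+y. ennreal (normal_density 0 (sqrt s) y) * ennreal (heat a (t - s) (x + y)) \<partial>lborel)
      = (\<integral>\<^sup>+y. \<integral>\<^sup>+u. ennreal (normal_density 0 (sqrt s) y) *
          (ennreal (normal_density 0 (sqrt (t - s)) (u - (x + y))) * indicator {-a..a} u) \<partial>lborel \<partial>lborel)"
    using assms by (intro nn_integral_cong)
      (simp add: ennreal_heat_translate nn_integral_cmult normal_density_def)
  also have "\<dots> = (\<integral>\<^sup>+u. \<integral>\<^sup>+y. ennreal (normal_density 0 (sqrt s) y) *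
          (ennreal (normal_density 0 (sqrt (t - s)) (u - (x + y))) * indicator {-a..a} u) \<partial>lborel \<partial>lborel)"
    by (intro lborel_pair.Fubini') (simp add: normal_density_def)
  also have "\<dots> = (\<integral>\<^sup>+u. (\<integral>\<^sup>+y. ennreal (normal_density 0 (sqrt (t - s)) ((u - x) - y) * normal_density 0 (sqrt s) y) \<partial>lborel)
          * indicator {-a..a} u \<partial>lborel)"
    by (intro nn_integral_cong, subst nn_integral_multc[symmetric])
      (auto simp: ennreal_mult mult_ac diff_diff_eq intro!: nn_integral_cong)
  also have "\<dots> = (\<integral>\<^sup>+u. ennreal (normal_density 0 (sqrt t) (u - x)) * indicator {-a..a} u \<partial>lborel)"
    using assms conv_normal_density_zero_mean[of "sqrt (t - s)" "sqrt s"]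
    by (simp add: fun_eq_iff)
  also have "\<dots> = ennreal (heat a t x)"
    using assms by (simp add: ennreal_heat_translate)
  finally show ?thesis .
qed

section \<open>Subtrees of labels, and hitting predicates as functions of the noise\<close>

definition descendants :: "particle \<Rightarrow> particle set" where
  "descendants v = range (\<lambda>u. u @ v)"

lemma self_descendant [simp]: "v \<in> descendants v"
  unfolding descendants_def by (metis append_Nil rangeI)

lemma descendants_Cons: "descendants (b # v) \<subseteq> descendants v"
proof
  fix w assume "w \<in> descendants (b # v)"
  then obtain u where "w = (u @ [b]) @ v" by (auto simp: descendants_def)
  then show "w \<in> descendants v" unfolding descendants_def by blast
qed

lemma not_descendant_child [simp]: "v \<notin> descendants (b # v)"
  by (auto simp: descendants_def dest: arg_cong[where f = length])

lemma descendants_children_disjoint: "descendants (True # v) \<inter> descendants (False # v) = {}"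
proof -
  have "u @ True # v \<noteq> w @ False # v" for u w :: particle
  proof
    assume eq: "u @ True # v = w @ False # v"
    then have "length u = length w" by (auto dest: arg_cong[where f = length])
    with eq show False by simp
  qed
  then show ?thesis by (auto simp: descendants_def)
qed

text \<open>
  In both predicates \<open>t\<close> is the target time counted from the birth of \<open>v\<close>, and \<open>x\<close> is the birth place of
  \<open>v\<close>. The lineage of \<open>v\<close> always continues with the child labelled \<open>True\<close>.
\<close>

primrec lineage_hits ::
  "real \<Rightarrow> real \<Rightarrow> nat \<Rightarrow> real \<Rightarrow> real \<Rightarrow> particle \<Rightarrow> (particle \<Rightarrow> real \<times> (real \<Rightarrow> real)) \<Rightarrow> bool" where
  "lineage_hits h e 0 t x v c \<longleftrightarrow> hit h e t x (c v)"
| "lineage_hits h e (Suc m) t x v c \<longleftrightarrow> hit h e t x (c v) \<or>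
     lineage_hits h e m (t - fst (c v)) \<bar>x + displacement (c v)\<bar> (True # v) c"

primrec all_miss ::
  "real \<Rightarrow> real \<Rightarrow> nat \<Rightarrow> nat \<Rightarrow> real \<Rightarrow> real \<Rightarrow> particle \<Rightarrow> (particle \<Rightarrow> real \<times> (real \<Rightarrow> real)) \<Rightarrow> bool" where
  "all_miss h e m 0 t x v c \<longleftrightarrow> \<not> lineage_hits h e m t x v c"
| "all_miss h e m (Suc n) t x v c \<longleftrightarrow>
     all_miss h e m n (t - fst (c v)) \<bar>x + displacement (c v)\<bar> (True # v) c \<and>
     all_miss h e m n (t - fst (c v)) \<bar>x + displacement (c v)\<bar> (False # v) c"

text \<open>Locality makes independence usable: the predicate may be evaluated on the configuration
  restricted to \<open>descendants v\<close>, which leaves out the parent and the sibling's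
  subtree.\<close>

lemma lineage_hits_local:
  "(\<And>u. u \<in> descendants v \<Longrightarrow> c u = c' u) \<Longrightarrow> lineage_hits h e m t x v c = lineage_hits h e m t x v c'"
proof (induction m arbitrary: t x v)
  case (Suc m)
  have "lineage_hits h e m s y (True # v) c = lineage_hits h e m s y (True # v) c'" for s y
    using Suc.prems descendants_Cons by (intro Suc.IH) blast
  then show ?case using Suc.prems[of v] by simp
qed simp

lemma all_miss_local:
  "(\<And>u. u \<in> descendants v \<Longrightarrow> c u = c' u) \<Longrightarrow> all_miss h e m n t x v c = all_miss h e m n t x v c'"
proof (induction n arbitrary: t x v)
  case 0
  then show ?case using lineage_hits_local[of v c c'] by simp
next
  case (Suc n)
  have "all_miss h e m n s y (b # v) c = all_miss h e m n s y (b # v) c'" for s y b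
    using Suc.prems descendants_Cons by (intro Suc.IH) blast
  then show ?case using Suc.prems[of v] by simp
qed

lemma measurable_component_descendant:
  assumes "c \<in> N \<rightarrow>\<^sub>M PiM D (\<lambda>_. noise_space)" "descendants v \<subseteq> D"
  shows "(\<lambda>w. c w v) \<in> N \<rightarrow>\<^sub>M noise_space"
  using assms self_descendant[of v]
  by (intro measurable_compose[OF assms(1) measurable_component_singleton]) blast

text \<open>Time and place must vary with \<open>w\<close>: one level down they have become
  functions of the noise of \<open>v\<close>, so fixed values would not survive the
  induction.\<close>

lemma measurable_lineage_hits [measurable (raw)]:
  assumes "t \<in> borel_measurable N" "x \<in> borel_measurable N"
    "c \<in> N \<rightarrow>\<^sub>M PiM D (\<lambda>_. noise_space)" "descendants v \<subseteq> D"
  shows "Measurable.pred N (\<lambda>w. lineage_hits h e m (t w) (x w) v (c w))"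
  using assms
proof (induction m arbitrary: t x v)
  case 0
  note [measurable] = 0 measurable_component_descendant[OF 0(3,4)]
  show ?case by simp
next
  case (Suc m)
  note [measurable] = Suc.prems(1-3) measurable_component_descendant[OF Suc.prems(3,4)]
  have [measurable]: "Measurable.pred N
      (\<lambda>w. lineage_hits h e m (t w - fst (c w v)) \<bar>x w + displacement (c w v)\<bar> (True # v) (c w))"
    using Suc.prems(4) descendants_Cons by (intro Suc.IH) (measurable, blast)
  show ?case by simp
qed

lemma measurable_all_miss [measurable (raw)]:
  assumes "t \<in> borel_measurable N" "x \<in> borel_measurable N"
    "c \<in> N \<rightarrow>\<^sub>M PiM D (\<lambda>_. noise_space)" "descendants v \<subseteq> D"
  shows "Measurable.pred N (\<lambda>w. all_miss h e m n (t w) (x w) v (c w))"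
  using assms
proof (induction n arbitrary: t x v)
  case 0
  note [measurable] = measurable_lineage_hits[OF 0]
  show ?case by simp
next
  case (Suc n)
  note [measurable] = Suc.prems(1-3) measurable_component_descendant[OF Suc.prems(3,4)]
  have [measurable]: "Measurable.pred N
      (\<lambda>w. all_miss h e m n (t w - fst (c w v)) \<bar>x w + displacement (c w v)\<bar> (b # v) (c w))" for b
    using Suc.prems(4) descendants_Cons by (intro Suc.IH) (measurable, blast)
  show ?case by simp
qed

context branching_reflected_brownian_motion
begin

abbreviation configuration :: "'a \<Rightarrow> particle \<Rightarrow> real \<times> (real \<Rightarrow> real)" where
  "configuration \<omega> \<equiv> (\<lambda>v. noise \<tau> B v \<omega>)"

lemma measurable_restrict_configuration [measurable]:
  "(\<lambda>\<omega>. restrict (configuration \<omega>) D) \<in> M \<rightarrow>\<^sub>M PiM D (\<lambda>_. noise_space)"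
  by (rule measurable_restrict) auto

lemma measurable_configuration [measurable]:
  "configuration \<in> M \<rightarrow>\<^sub>M PiM UNIV (\<lambda>_. noise_space)"
  using measurable_restrict_configuration[of UNIV] by (simp add: restrict_UNIV)

text \<open>The decomposition at the first split: the noise of \<open>v\<close> is frozen and that
  of its descendants sampled separately.\<close>

lemma prob_condition_on_noise:
  assumes "v \<notin> D"
    and G: "Measurable.pred (noise_space \<Otimes>\<^sub>M PiM D (\<lambda>_. noise_space)) (\<lambda>(z, c). G z c)"
  shows "prob {\<omega> \<in> space M. G (noise \<tau> B v \<omega>) (restrict (configuration \<omega>) D)}
    = expectation (\<lambda>\<omega>'. prob {\<omega> \<in> space M. G (noise \<tau> B v \<omega>') (restrict (configuration \<omega>) D)})"
    and "(\<lambda>\<omega>'. prob {\<omega> \<in> space M. G (noise \<tau> B v \<omega>') (restrict (configuration \<omega>) D)})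
      \<in> borel_measurable M"
proof -
  \<comment> \<open>\<open>indep_var_restrict\<close> compares restricted families, so the noise of
    \<open>v\<close> is presented as a configuration on \<open>{v}\<close>.\<close>
  let ?X = "\<lambda>\<omega>. restrict (configuration \<omega>) {v}" and ?Y = "\<lambda>\<omega>. restrict (configuration \<omega>) D"
  have G': "Measurable.pred (PiM {v} (\<lambda>_. noise_space) \<Otimes>\<^sub>M PiM D (\<lambda>_. noise_space)) (\<lambda>(a, c). G (a v) c)"
    using measurable_compose[of "\<lambda>p. (fst p v, snd p)"
        "PiM {v} (\<lambda>_. noise_space) \<Otimes>\<^sub>M PiM D (\<lambda>_. noise_space)", OF _ G]
    by (simp add: case_prod_beta)
  have "indep_var (PiM {v} (\<lambda>_. noise_space)) ?X (PiM D (\<lambda>_. noise_space)) ?Y"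
    using \<open>v \<notin> D\<close> by (intro indep_var_restrict[OF indep_noise]) auto
  then have "distr M (PiM {v} (\<lambda>_. noise_space)) ?X \<Otimes>\<^sub>M distr M (PiM D (\<lambda>_. noise_space)) ?Y
      = distr M (PiM {v} (\<lambda>_. noise_space) \<Otimes>\<^sub>M PiM D (\<lambda>_. noise_space)) (\<lambda>\<omega>. (?X \<omega>, ?Y \<omega>))"
    by (simp add: indep_var_distribution_eq)
  from product_law_prob_eq[OF measurable_restrict_configuration measurable_restrict_configuration this G']
  show "prob {\<omega> \<in> space M. G (noise \<tau> B v \<omega>) (?Y \<omega>)}
      = expectation (\<lambda>\<omega>'. prob {\<omega> \<in> space M. G (noise \<tau> B v \<omega>') (?Y \<omega>)})" by simp
  show "(\<lambda>\<omega>'. prob {\<omega> \<in> space M. G (noise \<tau> B v \<omega>') (?Y \<omega>)}) \<in> borel_measurable M"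
    by (rule measurable_compose[OF measurable_noise
          pair_section_measurable[OF measurable_restrict_configuration G]])
qed

text \<open>Tilting yields a multiple of the exponential density of rate
  \<open>1 - \<theta>\<close>. Later \<theta> is \<open>- 1\<close> for the truncation error of a
  lineage, \<open>1 / 2\<close> and \<open>1 / 8\<close> for \<open>excess\<close>, and
  \<open>- 2\<close> for birth times.\<close>

lemma nn_integral_exp_lifetime:
  assumes "\<theta> < 1"
  shows "(\<integral>\<^sup>+\<omega>. ennreal (exp (\<theta> * \<tau> v \<omega>)) \<partial>M) = ennreal (1 / (1 - \<theta>))"
proof -
  interpret E: prob_space "density lborel (exponential_density (1 - \<theta>))"
    using assms by (intro prob_space_exponential_density) simp
  have "(\<integral>\<^sup>+\<omega>. ennreal (exp (\<theta> * \<tau> v \<omega>)) \<partial>M)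
      = (\<integral>\<^sup>+s. ennreal (exponential_density 1 s) * ennreal (exp (\<theta> * s)) \<partial>lborel)"
    by (intro distributed_nn_integral[OF lifetime, symmetric]) auto
  also have "\<dots> = (\<integral>\<^sup>+s. ennreal (1 / (1 - \<theta>)) * ennreal (exponential_density (1 - \<theta>) s) \<partial>lborel)"
  proof (intro nn_integral_cong)
    fix s :: real
    have "exp (- s) * exp (\<theta> * s) = exp (- (s * (1 - \<theta>)))"
      by (simp add: algebra_simps flip: exp_add)
    then have "exponential_density 1 s * exp (\<theta> * s) = 1 / (1 - \<theta>) * exponential_density (1 - \<theta>) s"
      using assms by (simp add: exponential_density_def)
    moreover have "0 \<le> exponential_density 1 s" "0 \<le> 1 / (1 - \<theta>)"
      "0 \<le> exponential_density (1 - \<theta>) s"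
      using assms by (auto intro!: exponential_density_nonneg)
    ultimately show "ennreal (exponential_density 1 s) * ennreal (exp (\<theta> * s))
        = ennreal (1 / (1 - \<theta>)) * ennreal (exponential_density (1 - \<theta>) s)"
      by (metis ennreal_mult exp_ge_zero)
  qed
  also have "\<dots> = ennreal (1 / (1 - \<theta>)) * (\<integral>\<^sup>+s. ennreal (exponential_density (1 - \<theta>) s) \<partial>lborel)"
    by (intro nn_integral_cmult) auto
  also have "(\<integral>\<^sup>+s. ennreal (exponential_density (1 - \<theta>) s) \<partial>lborel) = 1"
    using E.emeasure_space_1 by (simp add: emeasure_density)
  finally show ?thesis by simp
qed

lemma AE_lifetime_neq: "AE \<omega> in M. \<tau> v \<omega> \<noteq> s"
proof -
  have "emeasure M (\<tau> v -` {s} \<inter> space M) = (\<integral>\<^sup>+r. ennreal (exponential_density 1 r) * indicator {s} r \<partial>lborel)"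
    by (intro distributed_emeasure[OF lifetime]) simp
  also have "\<dots> = (\<integral>\<^sup>+(r::real). 0 \<partial>lborel)"
    using AE_lborel_singleton[of s] by (intro nn_integral_cong_AE, eventually_elim) auto
  finally have "\<tau> v -` {s} \<inter> space M \<in> null_sets M"
    by (intro null_setsI) auto
  from AE_not_in[OF this] show ?thesis
    by (rule AE_mp) (intro AE_I2, auto)
qed

lemma prob_lifetime_less:
  assumes "0 < t"
  shows "prob {\<omega> \<in> space M. \<tau> v \<omega> \<in> {0<..<t}} = 1 - exp (- t)"
proof -
  have "prob {\<omega> \<in> space M. \<tau> v \<omega> \<in> {0<..<t}} = prob {\<omega> \<in> space M. \<tau> v \<omega> \<le> t}"
    using AE_lifetime_pos[of v] AE_lifetime_neq[of v t]
    by (intro finite_measure_eq_AE) auto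
  then show ?thesis
    using exponential_distributedD_le[OF lifetime[of v], of t] assms by simp
qed

text \<open>The renewal step: given a split at age \<open>s < t\<close>, averaging over its place
  returns \<open>heat a t x\<close> by the semigroup law, whatever \<open>s\<close> is. Only the
  probability of a split before \<open>t\<close> remains as a factor.\<close>

lemma nn_integral_heat_step:
  assumes "0 < t"
  shows "(\<integral>\<^sup>+\<omega>. indicator {0<..<t} (\<tau> v \<omega>) *
      ennreal (heat a (t - \<tau> v \<omega>) (x + displacement (noise \<tau> B v \<omega>))) \<partial>M)
    = ennreal ((1 - exp (- t)) * heat a t x)"
proof -
  have "(\<integral>\<^sup>+\<omega>. indicator {0<..<t} (\<tau> v \<omega>) *
      ennreal (heat a (t - \<tau> v \<omega>) (x + displacement (noise \<tau> B v \<omega>))) \<partial>M)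
    = (\<integral>\<^sup>+s. ennreal (exponential_density 1 s) * (\<integral>\<^sup>+y. ennreal (normal_density 0 (sqrt s) y) *
        (indicator {0<..<t} s * ennreal (heat a (t - s) (x + y))) \<partial>lborel) \<partial>lborel)"
    by (intro one_step_law) measurable
  also have "\<dots> = (\<integral>\<^sup>+s. ennreal (exponential_density 1 s) * (indicator {0<..<t} s * ennreal (heat a t x)) \<partial>lborel)"
  proof (intro nn_integral_cong arg_cong2[where f = "(*)"] refl)
    fix s
    show "(\<integral>\<^sup>+y. ennreal (normal_density 0 (sqrt s) y) *
        (indicator {0<..<t} s * ennreal (heat a (t - s) (x + y))) \<partial>lborel)
      = indicator {0<..<t} s * ennreal (heat a t x)"
      using heat_semigroup[of s t a x] by (auto split: split_indicator)
  qed
  also have "\<dots> = (\<integral>\<^sup>+\<omega>. indicator {0<..<t} (\<tau> v \<omega>) * ennreal (heat a t x) \<partial>M)"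
    by (intro distributed_nn_integral[OF lifetime]) auto
  also have "\<dots> = (\<integral>\<^sup>+\<omega>. indicator {\<omega> \<in> space M. \<tau> v \<omega> \<in> {0<..<t}} \<omega> * ennreal (heat a t x) \<partial>M)"
    by (intro nn_integral_cong) (auto split: split_indicator)
  also have "\<dots> = ennreal (prob {\<omega> \<in> space M. \<tau> v \<omega> \<in> {0<..<t}}) * ennreal (heat a t x)"
    by (subst nn_integral_multc) (auto simp: emeasure_eq_measure)
  also have "prob {\<omega> \<in> space M. \<tau> v \<omega> \<in> {0<..<t}} = 1 - exp (- t)"
    using assms by (rule prob_lifetime_less)
  finally show ?thesis
    using assms by (simp add: ennreal_mult heat_nonneg)
qed

text \<open>A first split after \<open>t + h\<close> carries the weight
  \<open>exp (- (t + h))\<close>, one before \<open>t\<close> the weight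
  \<open>exp (- h) * (1 - exp (- t))\<close>. They add up to \<open>exp (- h)\<close>, so the bound
  reproduces itself. The term \<open>exp t / 2 ^ m\<close> settles \<open>m = 0\<close> and halves
  at each split because \<open>exp (- \<tau> v \<omega>)\<close> has mean
  \<open>1 / 2\<close>.\<close>

lemma prob_lineage_hits_ge:
  assumes h: "0 < h" and a: "0 < a" and t: "0 < t"
  shows "exp (- h) * (heat a t x - 150000 * h\<^sup>2 / a ^ 4) - exp t / 2 ^ m
    \<le> prob {\<omega> \<in> space M. lineage_hits h (2 * a) m t x v (configuration \<omega>)}"
  using t
proof (induction m arbitrary: t x v)
  case 0
  define u where "u = exp (- h) * (heat a t x - 150000 * h\<^sup>2 / a ^ 4)"
  have "u \<le> 1 * 1"
  proof (cases "heat a t x - 150000 * h\<^sup>2 / a ^ 4 \<le> 0")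
    case True
    then have "u \<le> 0" by (simp add: u_def mult_nonneg_nonpos)
    then show ?thesis by simp
  next
    case False
    have "0 \<le> 150000 * h\<^sup>2 / a ^ 4" using a by simp
    then have "heat a t x - 150000 * h\<^sup>2 / a ^ 4 \<le> 1"
      using heat_le_1[OF 0, of a x] by linarith
    then show ?thesis unfolding u_def using h False by (intro mult_mono) auto
  qed
  \<comment> \<open>For nonnegative \<open>u\<close> the left side is at most 0, since
    \<open>u\<close> is at most 1; a negative \<open>u\<close> only grows when multiplied by
    \<open>exp (- t)\<close>.\<close>
  have "u - exp t \<le> exp (- t) * u"
  proof (cases "0 \<le> u")
    case True
    have "1 \<le> exp t" "0 \<le> exp (- t) * u" using 0 True by auto
    then show ?thesis using \<open>u \<le> 1 * 1\<close> by linarith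
  next
    case False
    have "exp (- t) \<le> 1" using 0 by simp
    then have "1 * u \<le> exp (- t) * u" using False by (intro mult_right_mono_neg) auto
    then show ?thesis using exp_gt_zero[of t] by linarith
  qed
  also have "exp (- t) * u = exp (- (t + h)) * (heat a t x - 150000 * h\<^sup>2 / a ^ 4)"
    by (simp add: u_def exp_diff exp_minus field_simps exp_add)
  also have "\<dots> \<le> prob {\<omega> \<in> space M. hit h (2 * a) t x (noise \<tau> B v \<omega>)}"
    using 0 h a by (rule prob_hit_ge)
  finally show ?case by (simp add: u_def)
next
  case (Suc m)
  define c where "c = 150000 * h\<^sup>2 / a ^ 4"
  have c: "0 \<le> c" using a by (simp add: c_def)
  let ?D = "descendants (True # v)"
  \<comment> \<open>The added guard \<open>fst z < t\<close> keeps the remaining time positive for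
    the induction hypothesis and makes the event disjoint from a hit by \<open>v\<close> itself,
    which needs a lifetime above \<open>t + h\<close>.\<close>
  let ?G = "\<lambda>z d. fst z < t \<and> lineage_hits h (2 * a) m (t - fst z) \<bar>x + displacement z\<bar> (True # v) d"
  let ?\<xi> = "\<lambda>\<omega>. displacement (noise \<tau> B v \<omega>)"
  define F where "F \<omega>' = prob {\<omega> \<in> space M. ?G (noise \<tau> B v \<omega>') (restrict (configuration \<omega>) ?D)}" for \<omega>'
  define H where "H = {\<omega> \<in> space M. hit h (2 * a) t x (noise \<tau> B v \<omega>)}"
  define L where "L = {\<omega> \<in> space M. ?G (noise \<tau> B v \<omega>) (restrict (configuration \<omega>) ?D)}"
  have local: "lineage_hits h (2 * a) m s y (True # v) (restrict (configuration \<omega>) ?D)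
      = lineage_hits h (2 * a) m s y (True # v) (configuration \<omega>)" for s y \<omega>
    by (rule lineage_hits_local) simp
  have G: "Measurable.pred (noise_space \<Otimes>\<^sub>M PiM ?D (\<lambda>_. noise_space)) (\<lambda>(z, d). ?G z d)"
    unfolding case_prod_beta by measurable
  have [measurable]: "Measurable.pred M (\<lambda>\<omega>. ?G (noise \<tau> B v \<omega>) (restrict (configuration \<omega>) ?D))"
    by measurable
  have [measurable]: "H \<in> events" "L \<in> events" unfolding H_def L_def by measurable
  have L: "prob L = expectation F" and [measurable]: "F \<in> borel_measurable M"
    unfolding L_def F_def by (rule prob_condition_on_noise[OF _ G]; simp)+
  define J :: "'a \<Rightarrow> real" where "J \<omega> = indicator {0<..<t} (\<tau> v \<omega>)" for \<omega>
  have [measurable]: "random_variable borel J" unfolding J_def by measurable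
  have J01: "0 \<le> J \<omega>" "J \<omega> \<le> 1" for \<omega> by (auto simp: J_def)
  have J0: "J \<omega> = 0" if "\<tau> v \<omega> \<notin> {0<..<t}" for \<omega> using that by (simp add: J_def)
  define P where "P \<omega> = J \<omega> * heat a (t - \<tau> v \<omega>) (x + ?\<xi> \<omega>)" for \<omega>
  define W where "W \<omega> = J \<omega> * exp (t - \<tau> v \<omega>)" for \<omega>
  have [measurable]: "random_variable borel P" "random_variable borel W"
    unfolding P_def W_def by measurable
  have P01: "0 \<le> P \<omega>" "P \<omega> \<le> 1" for \<omega>
  proof -
    show "0 \<le> P \<omega>" using J01 by (simp add: P_def heat_nonneg)
    show "P \<omega> \<le> 1"
      using J0[of \<omega>] J01[of \<omega>] heat_le_1[of "t - \<tau> v \<omega>" a "x + ?\<xi> \<omega>"]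
      by (cases "\<tau> v \<omega> \<in> {0<..<t}") (auto simp: P_def intro!: mult_le_one heat_nonneg)
  qed
  have W: "0 \<le> W \<omega>" "W \<omega> \<le> exp t" for \<omega>
  proof -
    show "0 \<le> W \<omega>" using J01 by (simp add: W_def)
    show "W \<omega> \<le> exp t" by (auto simp: W_def J_def split: split_indicator)
  qed
  have int: "integrable M J" "integrable M P" "integrable M W" "integrable M F"
    using J01 P01 W by (auto intro!: integrable_const_bound[where B = 1]
        integrable_const_bound[where B = "exp t" and f = W] simp: F_def)
  have EJ: "expectation J = 1 - exp (- t)"
  proof -
    have "expectation J = expectation (indicator {\<omega> \<in> space M. \<tau> v \<omega> \<in> {0<..<t}})"
      by (intro Bochner_Integration.integral_cong) (auto simp: J_def split: split_indicator)
    then show ?thesis using prob_lifetime_less[OF Suc.prems, of v] by simp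
  qed
  have EP: "expectation P = (1 - exp (- t)) * heat a t x"
  proof -
    have "ennreal (P \<omega>) = indicator {0<..<t} (\<tau> v \<omega>) * ennreal (heat a (t - \<tau> v \<omega>) (x + ?\<xi> \<omega>))" for \<omega>
      by (auto simp: P_def J_def split: split_indicator)
    then have "(\<integral>\<^sup>+\<omega>. ennreal (P \<omega>) \<partial>M) = ennreal ((1 - exp (- t)) * heat a t x)"
      using nn_integral_heat_step[OF Suc.prems, of v a x] by simp
    then show ?thesis
      using Suc.prems P01 by (subst integral_eq_nn_integral) (auto simp: heat_nonneg)
  qed
  have EW: "expectation W \<le> exp t / 2"
  proof (rule integral_real_bounded)
    have "(\<integral>\<^sup>+\<omega>. ennreal (W \<omega>) \<partial>M) \<le> (\<integral>\<^sup>+\<omega>. ennreal (exp t) * ennreal (exp (- 1 * \<tau> v \<omega>)) \<partial>M)"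
      using J01 by (intro nn_integral_mono)
        (auto simp: W_def J_def exp_diff exp_minus divide_inverse ennreal_mult[symmetric] split: split_indicator)
    also have "\<dots> = ennreal (exp t) * ennreal (1 / (1 - (- 1)))"
      using nn_integral_exp_lifetime[of "-1" v] by (subst nn_integral_cmult) auto
    also have "\<dots> = ennreal (exp t / 2)" by (subst ennreal_mult[symmetric]) auto
    finally show "(\<integral>\<^sup>+\<omega>. ennreal (W \<omega>) \<partial>M) \<le> ennreal (exp t / 2)" .
  qed simp
  have "AE \<omega> in M. exp (- h) * (P \<omega> - c * J \<omega>) - W \<omega> / 2 ^ m \<le> F \<omega>"
    using AE_lifetime_pos[of v]
  proof eventually_elim
    case (elim \<omega>')
    show ?case
    proof (cases "\<tau> v \<omega>' < t")
      case True
      have "F \<omega>' = prob {\<omega> \<in> space M. lineage_hits h (2 * a) m (t - \<tau> v \<omega>') \<bar>x + ?\<xi> \<omega>'\<bar> (True # v) (configuration \<omega>)}"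
        using True by (simp add: F_def local) (simp add: noise_def)
      with Suc.IH[of "t - \<tau> v \<omega>'" "\<bar>x + ?\<xi> \<omega>'\<bar>" "True # v"] True elim show ?thesis
        by (simp add: P_def J_def W_def c_def heat_abs)
    next
      case False
      then have "J \<omega>' = 0" by (intro J0) auto
      then show ?thesis by (simp add: P_def W_def F_def)
    qed
  qed
  then have "expectation (\<lambda>\<omega>. exp (- h) * (P \<omega> - c * J \<omega>) - W \<omega> / 2 ^ m) \<le> prob L"
    unfolding L using int by (intro integral_mono_AE) auto
  also have "expectation (\<lambda>\<omega>. exp (- h) * (P \<omega> - c * J \<omega>) - W \<omega> / 2 ^ m)
      = exp (- h) * (expectation P - c * expectation J) - expectation W / 2 ^ m"
    using int by simp
  finally have "exp (- h) * ((1 - exp (- t)) * heat a t x - c * (1 - exp (- t))) - expectation W / 2 ^ m \<le> prob L"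
    by (simp add: EP EJ)
  moreover have "expectation W / 2 ^ m \<le> exp t / 2 / 2 ^ m"
    by (intro divide_right_mono EW) simp
  moreover have "exp (- (t + h)) * (heat a t x - c) \<le> prob H"
    unfolding H_def c_def using Suc.prems h a by (rule prob_hit_ge)
  moreover have "exp (- (t + h)) * (heat a t x - c)
      + exp (- h) * ((1 - exp (- t)) * heat a t x - c * (1 - exp (- t))) = exp (- h) * (heat a t x - c)"
    by (simp add: exp_add exp_diff exp_minus field_simps)
  moreover have "exp t / 2 / 2 ^ m = exp t / 2 ^ Suc m" by simp
  ultimately have "exp (- h) * (heat a t x - c) - exp t / 2 ^ Suc m \<le> prob H + prob L"
    by linarith
  also have "H \<inter> L = {}"
    using h by (auto simp: H_def L_def hit_def)
  then have "prob H + prob L = prob (H \<union> L)"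
    by (intro finite_measure_Union[symmetric]) auto
  also have "\<dots> \<le> prob {\<omega> \<in> space M. lineage_hits h (2 * a) (Suc m) t x v (configuration \<omega>)}"
    by (intro finite_measure_mono) (auto simp: H_def L_def local simp del: restrict_apply)
  finally show ?case unfolding c_def .
qed

end

section \<open>All members of a generation\<close>

lemma nn_integral_normal_exp:
  assumes "0 < s"
  shows "(\<integral>\<^sup>+y. ennreal (normal_density 0 (sqrt s) y) * ennreal (exp (\<theta> * y)) \<partial>lborel)
    = ennreal (exp (\<theta>\<^sup>2 / 2 * s))"
proof -
  interpret N: prob_space "density lborel (normal_density (\<theta> * s) (sqrt s))"
    using assms by (intro prob_space_normal_density) simp
  have "normal_density 0 (sqrt s) y * exp (\<theta> * y) = exp (\<theta>\<^sup>2 / 2 * s) * normal_density (\<theta> * s) (sqrt s) y" for y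
  proof -
    have "- (y - 0)\<^sup>2 / (2 * (sqrt s)\<^sup>2) + \<theta> * y = \<theta>\<^sup>2 / 2 * s + - (y - \<theta> * s)\<^sup>2 / (2 * (sqrt s)\<^sup>2)"
      using assms by (simp add: field_simps power2_eq_square)
    then have "exp (- (y - 0)\<^sup>2 / (2 * (sqrt s)\<^sup>2)) * exp (\<theta> * y)
        = exp (\<theta>\<^sup>2 / 2 * s) * exp (- (y - \<theta> * s)\<^sup>2 / (2 * (sqrt s)\<^sup>2))"
      by (simp only: exp_add[symmetric])
    then show ?thesis unfolding normal_density_def by simp
  qed
  then have "(\<integral>\<^sup>+y. ennreal (normal_density 0 (sqrt s) y) * ennreal (exp (\<theta> * y)) \<partial>lborel)
      = (\<integral>\<^sup>+y. ennreal (exp (\<theta>\<^sup>2 / 2 * s)) * ennreal (normal_density (\<theta> * s) (sqrt s) y) \<partial>lborel)"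
    by (intro nn_integral_cong) (simp flip: ennreal_mult)
  also have "\<dots> = ennreal (exp (\<theta>\<^sup>2 / 2 * s)) * (\<integral>\<^sup>+y. ennreal (normal_density (\<theta> * s) (sqrt s) y) \<partial>lborel)"
    by (intro nn_integral_cmult) auto
  also have "(\<integral>\<^sup>+y. ennreal (normal_density (\<theta> * s) (sqrt s) y) \<partial>lborel) = 1"
    using N.emeasure_space_1 by (simp add: emeasure_density)
  finally show ?thesis by simp
qed

text \<open>
  Bounds the probability that a lineage, after \<open>n\<close> splits, has remaining time at most \<open>T0\<close> or is at
  distance at least \<open>R\<close>. Each split costs a factor \<open>2\<close>, the value of the exponential moment of order
  \<open>1 / 2\<close> of a lifetime.
\<close>

definition excess :: "real \<Rightarrow> real \<Rightarrow> nat \<Rightarrow> real \<Rightarrow> real \<Rightarrow> real" where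
  "excess T0 R n t x =
     2 ^ n * (exp ((T0 - t) / 2) + exp (- R / 2) * (exp (x / 2) + exp (- x / 2)))"

lemma excess_nonneg: "0 \<le> excess T0 R n t x"
  by (simp add: excess_def add_nonneg_nonneg)

lemma excess_ge_1:
  assumes "t \<le> T0 \<or> R \<le> \<bar>x\<bar>"
  shows "1 \<le> excess T0 R 0 t x"
proof (cases "t \<le> T0")
  case True
  then have "1 \<le> exp ((T0 - t) / 2)" by simp
  then show ?thesis by (simp add: excess_def add_increasing2)
next
  case False
  then have "1 \<le> exp (- R / 2) * exp (\<bar>x\<bar> / 2)"
    using assms by (simp flip: exp_add)
  also have "\<dots> \<le> exp (- R / 2) * (exp (x / 2) + exp (- x / 2))"
    by (cases "0 \<le> x") auto
  finally show ?thesis by (simp add: excess_def add_increasing)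
qed

text \<open>The sum \<open>exp (x / 2) + exp (- x / 2)\<close> is even, so reflection at a split is
  harmless, and it consists of pure exponentials, so that adding a displacement factorises.
  \<open>exp (\<bar>x\<bar> / 2)\<close> has only the first property.\<close>

lemma excess_abs: "excess T0 R n t \<bar>x\<bar> = excess T0 R n t x"
  by (cases "0 \<le> x") (auto simp: excess_def add.commute)

lemma measurable_excess [measurable (raw)]:
  assumes [measurable]: "f \<in> borel_measurable N" "g \<in> borel_measurable N"
  shows "(\<lambda>w. excess T0 R n (f w) (g w)) \<in> borel_measurable N"
  unfolding excess_def by measurable

context branching_reflected_brownian_motion
begin

text \<open>Given the lifetime \<open>s\<close>, the displacement is Gaussian with variance
  \<open>s\<close>; its exponential moment is that of a lifetime at the order
  \<open>\<theta>\<^sup>2 / 2\<close>.\<close>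

lemma nn_integral_exp_displacement:
  "(\<integral>\<^sup>+\<omega>. ennreal (exp (\<theta> * displacement (noise \<tau> B v \<omega>))) \<partial>M)
    = (\<integral>\<^sup>+\<omega>. ennreal (exp (\<theta>\<^sup>2 / 2 * \<tau> v \<omega>)) \<partial>M)"
proof -
  have "(\<integral>\<^sup>+\<omega>. ennreal (exp (\<theta> * displacement (noise \<tau> B v \<omega>))) \<partial>M)
      = (\<integral>\<^sup>+s. ennreal (exponential_density 1 s) *
        (\<integral>\<^sup>+y. ennreal (normal_density 0 (sqrt s) y) * ennreal (exp (\<theta> * y)) \<partial>lborel) \<partial>lborel)"
    by (rule one_step_law) simp
  also have "\<dots> = (\<integral>\<^sup>+s. ennreal (exponential_density 1 s) * ennreal (exp (\<theta>\<^sup>2 / 2 * s)) \<partial>lborel)"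
    using AE_lborel_singleton[of "0::real"]
  proof (intro nn_integral_cong_AE, eventually_elim)
    case (elim s)
    then show ?case
      by (cases "0 < s") (simp_all add: nn_integral_normal_exp exponential_density_def)
  qed
  also have "\<dots> = (\<integral>\<^sup>+\<omega>. ennreal (exp (\<theta>\<^sup>2 / 2 * \<tau> v \<omega>)) \<partial>M)"
    by (intro distributed_nn_integral[OF lifetime]) auto
  finally show ?thesis .
qed

lemma nn_integral_excess_step:
  "(\<integral>\<^sup>+\<omega>. ennreal (excess T0 R n (t - \<tau> v \<omega>) (x + displacement (noise \<tau> B v \<omega>))) \<partial>M)
    \<le> ennreal (excess T0 R (Suc n) t x)"
proof -
  let ?\<xi> = "\<lambda>\<omega>. displacement (noise \<tau> B v \<omega>)"
  \<comment> \<open>Here the lifetime moment has order \<open>1 / 8\<close> and equals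
    \<open>8 / 7\<close>; it is rounded up to the factor 2 that the time term costs anyway.\<close>
  have half: "(\<integral>\<^sup>+\<omega>. ennreal (exp (\<theta> * ?\<xi> \<omega>)) \<partial>M) \<le> ennreal 2" if "\<theta>\<^sup>2 = 1 / 4" for \<theta>
    unfolding nn_integral_exp_displacement that using nn_integral_exp_lifetime[of "1/8" v]
    by (simp add: ennreal_leI del: ennreal_numeral)
  have "(\<integral>\<^sup>+\<omega>. ennreal (excess T0 R n (t - \<tau> v \<omega>) (x + ?\<xi> \<omega>)) \<partial>M)
      = (\<integral>\<^sup>+\<omega>. ennreal (2 ^ n * exp ((T0 - t) / 2)) * ennreal (exp (1 / 2 * \<tau> v \<omega>))
          + ennreal (2 ^ n * exp (- R / 2) * exp (x / 2)) * ennreal (exp (1 / 2 * ?\<xi> \<omega>))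
          + ennreal (2 ^ n * exp (- R / 2) * exp (- x / 2)) * ennreal (exp (- 1 / 2 * ?\<xi> \<omega>)) \<partial>M)"
  proof (intro nn_integral_cong)
    fix \<omega>
    have "exp ((T0 - (t - \<tau> v \<omega>)) / 2) = exp ((T0 - t) / 2) * exp (1 / 2 * \<tau> v \<omega>)"
      "exp ((x + ?\<xi> \<omega>) / 2) = exp (x / 2) * exp (1 / 2 * ?\<xi> \<omega>)"
      "exp (- (x + ?\<xi> \<omega>) / 2) = exp (- x / 2) * exp (- 1 / 2 * ?\<xi> \<omega>)"
      by (simp_all add: field_simps flip: exp_add)
    then have "excess T0 R n (t - \<tau> v \<omega>) (x + ?\<xi> \<omega>)
        = 2 ^ n * exp ((T0 - t) / 2) * exp (1 / 2 * \<tau> v \<omega>)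
          + 2 ^ n * exp (- R / 2) * exp (x / 2) * exp (1 / 2 * ?\<xi> \<omega>)
          + 2 ^ n * exp (- R / 2) * exp (- x / 2) * exp (- 1 / 2 * ?\<xi> \<omega>)"
      unfolding excess_def by (simp only: distrib_left mult.assoc add.assoc)
    then show "ennreal (excess T0 R n (t - \<tau> v \<omega>) (x + ?\<xi> \<omega>))
        = ennreal (2 ^ n * exp ((T0 - t) / 2)) * ennreal (exp (1 / 2 * \<tau> v \<omega>))
          + ennreal (2 ^ n * exp (- R / 2) * exp (x / 2)) * ennreal (exp (1 / 2 * ?\<xi> \<omega>))
          + ennreal (2 ^ n * exp (- R / 2) * exp (- x / 2)) * ennreal (exp (- 1 / 2 * ?\<xi> \<omega>))"
      by (simp only: ennreal_mult[symmetric] ennreal_plus[symmetric] exp_ge_zero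
          mult_nonneg_nonneg add_nonneg_nonneg zero_le_power zero_le_numeral)
  qed
  also have "\<dots> = ennreal (2 ^ n * exp ((T0 - t) / 2)) * (\<integral>\<^sup>+\<omega>. ennreal (exp (1 / 2 * \<tau> v \<omega>)) \<partial>M)
      + ennreal (2 ^ n * exp (- R / 2) * exp (x / 2)) * (\<integral>\<^sup>+\<omega>. ennreal (exp (1 / 2 * ?\<xi> \<omega>)) \<partial>M)
      + ennreal (2 ^ n * exp (- R / 2) * exp (- x / 2)) * (\<integral>\<^sup>+\<omega>. ennreal (exp (- 1 / 2 * ?\<xi> \<omega>)) \<partial>M)"
    by (subst nn_integral_add nn_integral_cmult; measurable)+
  also have "\<dots> \<le> ennreal (2 ^ n * exp ((T0 - t) / 2)) * ennreal 2
      + ennreal (2 ^ n * exp (- R / 2) * exp (x / 2)) * ennreal 2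
      + ennreal (2 ^ n * exp (- R / 2) * exp (- x / 2)) * ennreal 2"
  proof (intro add_mono mult_left_mono half)
    show "(\<integral>\<^sup>+\<omega>. ennreal (exp (1 / 2 * \<tau> v \<omega>)) \<partial>M) \<le> ennreal 2"
      using nn_integral_exp_lifetime[of "1/2" v] by simp
  qed (auto simp: power2_eq_square)
  also have "\<dots> = ennreal (2 ^ n * exp ((T0 - t) / 2) * 2
      + 2 ^ n * exp (- R / 2) * exp (x / 2) * 2 + 2 ^ n * exp (- R / 2) * exp (- x / 2) * 2)"
    by (simp only: ennreal_mult[symmetric] ennreal_plus[symmetric] exp_ge_zero
          mult_nonneg_nonneg add_nonneg_nonneg zero_le_power zero_le_numeral)
  also have "\<dots> = ennreal (excess T0 R (Suc n) t x)"
    by (simp add: excess_def algebra_simps)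
  finally show ?thesis .
qed

lemma prob_disjoint_subtrees:
  assumes "D \<inter> D' = {}"
    and [measurable]: "Measurable.pred (PiM D (\<lambda>_. noise_space)) P"
      "Measurable.pred (PiM D' (\<lambda>_. noise_space)) Q"
  shows "prob {\<omega> \<in> space M. P (restrict (configuration \<omega>) D) \<and> Q (restrict (configuration \<omega>) D')}
    = prob {\<omega> \<in> space M. P (restrict (configuration \<omega>) D)}
      * prob {\<omega> \<in> space M. Q (restrict (configuration \<omega>) D')}"
proof -
  let ?S = "PiM D (\<lambda>_. noise_space)" and ?S' = "PiM D' (\<lambda>_. noise_space)"
  let ?X = "\<lambda>\<omega>. restrict (configuration \<omega>) D" and ?X' = "\<lambda>\<omega>. restrict (configuration \<omega>) D'"
  have "indep_var ?S ?X ?S' ?X'"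
    using assms(1) by (intro indep_var_restrict[OF indep_noise]) auto
  then have "prob ((\<lambda>\<omega>. (?X \<omega>, ?X' \<omega>)) -` ({c \<in> space ?S. P c} \<times> {c \<in> space ?S'. Q c}) \<inter> space M)
      = prob (?X -` {c \<in> space ?S. P c} \<inter> space M) * prob (?X' -` {c \<in> space ?S'. Q c} \<inter> space M)"
    by (rule indep_varD) measurable
  moreover have "(\<lambda>\<omega>. (?X \<omega>, ?X' \<omega>)) -` ({c \<in> space ?S. P c} \<times> {c \<in> space ?S'. Q c}) \<inter> space M
      = {\<omega> \<in> space M. P (?X \<omega>) \<and> Q (?X' \<omega>)}"
    "?X -` {c \<in> space ?S. P c} \<inter> space M = {\<omega> \<in> space M. P (?X \<omega>)}"
    "?X' -` {c \<in> space ?S'. Q c} \<inter> space M = {\<omega> \<in> space M. Q (?X' \<omega>)}"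
    using measurable_space[OF measurable_restrict_configuration] by auto
  ultimately show ?thesis by simp
qed

text \<open>The capped \<open>excess\<close> stands in for the chance that a member is bad. What
  counts is that it equals 1 at bad times and places, and that its mean over the first split is at
  most its value one generation up.\<close>

lemma prob_all_miss_le:
  assumes p: "0 \<le> p" "p \<le> 1"
    and hits: "\<And>v t x. T0 \<le> t \<Longrightarrow> t \<le> T \<Longrightarrow> \<bar>x\<bar> \<le> R \<Longrightarrow>
      p \<le> prob {\<omega> \<in> space M. lineage_hits h e m t x v (configuration \<omega>)}"
    and "t \<le> T"
  shows "prob {\<omega> \<in> space M. all_miss h e m n t x v (configuration \<omega>)}
    \<le> (1 - p) ^ 2 ^ n + (1 - (1 - p) ^ 2 ^ n) * min 1 (excess T0 R n t x)"
  using \<open>t \<le> T\<close>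
proof (induction n arbitrary: t x v)
  case 0
  show ?case
  proof (cases "T0 \<le> t \<and> \<bar>x\<bar> \<le> R")
    case True
    have [measurable]: "Measurable.pred M (\<lambda>\<omega>. lineage_hits h e m t x v (configuration \<omega>))"
      by (rule measurable_lineage_hits[where D = UNIV]) auto
    have "prob {\<omega> \<in> space M. \<not> lineage_hits h e m t x v (configuration \<omega>)}
        = 1 - prob {\<omega> \<in> space M. lineage_hits h e m t x v (configuration \<omega>)}"
      by (rule prob_neg) simp
    also have "\<dots> \<le> 1 - p" using hits[of t x v] True 0 by simp
    also have "\<dots> \<le> (1 - p) + p * min 1 (excess T0 R 0 t x)"
      using p excess_nonneg by simp
    finally show ?thesis by simp
  next
    case False
    \<comment> \<open>At a bad time or place the cap is attained and the claimed bound is 1.\<close>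
    then have "1 \<le> excess T0 R 0 t x" by (intro excess_ge_1) auto
    then show ?thesis by (simp add: min_absorb1)
  qed
next
  case (Suc n)
  define Q where "Q = (1 - p) ^ 2 ^ n"
  have Q: "0 \<le> Q" "Q \<le> 1" "(1 - p) ^ 2 ^ Suc n = Q\<^sup>2"
    using p by (auto simp: Q_def power_le_one mult.commute simp flip: power_mult)
  let ?\<xi> = "\<lambda>\<omega>. displacement (noise \<tau> B v \<omega>)"
  let ?D = "\<lambda>b. descendants (b # v)"
  let ?D2 = "?D True \<union> ?D False"
  let ?m = "\<lambda>b z d. all_miss h e m n (t - fst z) \<bar>x + displacement z\<bar> (b # v) d"
  let ?G = "\<lambda>z d. ?m True z d \<and> ?m False z d"
  define F where "F \<omega>' = prob {\<omega> \<in> space M. ?G (noise \<tau> B v \<omega>') (restrict (configuration \<omega>) ?D2)}" for \<omega>'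
  \<comment> \<open>Capping at 1 makes \<open>z\<close> a mixing weight, as the convexity step
    needs.\<close>
  define z where "z \<omega> = min 1 (excess T0 R n (t - \<tau> v \<omega>) (x + ?\<xi> \<omega>))" for \<omega>
  have [measurable]: "random_variable borel z" unfolding z_def by measurable
  have z: "0 \<le> z \<omega>" "z \<omega> \<le> 1" for \<omega>
    by (auto simp: z_def excess_nonneg)
  have local: "all_miss h e m n s y (b # v) (restrict (configuration \<omega>) E)
      = all_miss h e m n s y (b # v) (configuration \<omega>)" if "?D b \<subseteq> E" for s y \<omega> b E
    using that by (intro all_miss_local) auto
  have G: "Measurable.pred (noise_space \<Otimes>\<^sub>M PiM ?D2 (\<lambda>_. noise_space)) (\<lambda>(z, d). ?G z d)"
    unfolding case_prod_beta
    by (intro pred_intros_logic measurable_all_miss[where D = ?D2]) simp_all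
  have "prob {\<omega> \<in> space M. all_miss h e m (Suc n) t x v (configuration \<omega>)}
      = prob {\<omega> \<in> space M. ?G (noise \<tau> B v \<omega>) (restrict (configuration \<omega>) ?D2)}"
    by (simp add: local)
  also have "\<dots> = expectation F"
    unfolding F_def by (rule prob_condition_on_noise(1)[OF _ G]) simp
  also have "\<dots> \<le> expectation (\<lambda>\<omega>. Q\<^sup>2 + (1 - Q\<^sup>2) * z \<omega>)"
  proof (rule integral_mono_AE)
    have "F \<in> borel_measurable M"
      unfolding F_def by (rule prob_condition_on_noise(2)[OF _ G]) simp
    then show "integrable M F"
      by (intro integrable_const_bound[where B = 1]) (auto simp: F_def)
    show "integrable M (\<lambda>\<omega>. Q\<^sup>2 + (1 - Q\<^sup>2) * z \<omega>)"
      using z by (intro Bochner_Integration.integrable_add integrable_mult_right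
          integrable_const_bound[where B = 1 and f = z]) auto
    \<comment> \<open>Positivity of the lifetime keeps the remaining time at most \<open>T\<close>,
      as the induction hypothesis demands.\<close>
    show "AE \<omega> in M. F \<omega> \<le> Q\<^sup>2 + (1 - Q\<^sup>2) * z \<omega>"
      using AE_lifetime_pos[of v]
    proof eventually_elim
      case (elim \<omega>')
      let ?s = "t - \<tau> v \<omega>'" and ?y = "\<bar>x + ?\<xi> \<omega>'\<bar>"
      have meas: "Measurable.pred (PiM (?D b) (\<lambda>_. noise_space)) (all_miss h e m n ?s ?y (b # v))" for b
        by (rule measurable_all_miss[where D = "?D b"]) auto
      have child: "prob {\<omega> \<in> space M. all_miss h e m n ?s ?y (b # v) (configuration \<omega>)} \<le> Q + (1 - Q) * z \<omega>'" for b
        using Suc.IH[of ?s ?y "b # v"] Suc.prems elim by (simp add: Q_def z_def excess_abs)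
      have "F \<omega>' = prob {\<omega> \<in> space M. all_miss h e m n ?s ?y (True # v) (restrict (configuration \<omega>) (?D True))
            \<and> all_miss h e m n ?s ?y (False # v) (restrict (configuration \<omega>) (?D False))}"
        by (simp add: F_def local) (simp add: noise_def)
      also have "\<dots> = prob {\<omega> \<in> space M. all_miss h e m n ?s ?y (True # v) (configuration \<omega>)}
          * prob {\<omega> \<in> space M. all_miss h e m n ?s ?y (False # v) (configuration \<omega>)}"
        by (subst prob_disjoint_subtrees[OF descendants_children_disjoint meas meas]) (simp add: local)
      also have "\<dots> \<le> (Q + (1 - Q) * z \<omega>') * (Q + (1 - Q) * z \<omega>')"
      proof (intro mult_mono child)
        show "0 \<le> Q + (1 - Q) * z \<omega>'" using Q z by simp
      qed auto
      \<comment> \<open>The subtracted term is the convexity gap of squaring for the values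
        \<open>Q\<close> and 1 mixed with weights \<open>1 - z\<close> and \<open>z\<close>.\<close>
      also have "\<dots> = Q\<^sup>2 + (1 - Q\<^sup>2) * z \<omega>' - z \<omega>' * (1 - z \<omega>') * (1 - Q)\<^sup>2"
        by (simp add: algebra_simps power2_eq_square)
      also have "\<dots> \<le> Q\<^sup>2 + (1 - Q\<^sup>2) * z \<omega>'"
        using z by simp
      finally show ?case .
    qed
  qed
  also have "\<dots> = Q\<^sup>2 + (1 - Q\<^sup>2) * expectation z"
    using z by (subst Bochner_Integration.integral_add)
      (auto simp: prob_space intro!: integrable_const_bound[where B = 1 and f = z])
  also have "\<dots> \<le> Q\<^sup>2 + (1 - Q\<^sup>2) * min 1 (excess T0 R (Suc n) t x)"
  proof (intro add_left_mono mult_left_mono min.boundedI)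
    show "expectation z \<le> 1"
      using z by (intro integral_le_const integrable_const_bound[where B = 1]) auto
    show "expectation z \<le> excess T0 R (Suc n) t x"
    proof (rule integral_real_bounded[OF excess_nonneg])
      have "(\<integral>\<^sup>+\<omega>. ennreal (z \<omega>) \<partial>M)
          \<le> (\<integral>\<^sup>+\<omega>. ennreal (excess T0 R n (t - \<tau> v \<omega>) (x + ?\<xi> \<omega>)) \<partial>M)"
        by (intro nn_integral_mono ennreal_leI) (simp add: z_def)
      also have "\<dots> \<le> ennreal (excess T0 R (Suc n) t x)"
        by (rule nn_integral_excess_step)
      finally show "(\<integral>\<^sup>+\<omega>. ennreal (z \<omega>) \<partial>M) \<le> ennreal (excess T0 R (Suc n) t x)" .
    qed
    show "0 \<le> 1 - Q\<^sup>2" using Q by (simp add: power_le_one)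
  qed
  finally show ?case unfolding Q(3) .
qed

end

section \<open>Almost sure convergence\<close>

lemma heat_ge:
  assumes "0 < a" "0 < t0" "t0 \<le> t" "t \<le> T" "\<bar>x\<bar> \<le> R"
  shows "2 * a * exp (- (R + a)\<^sup>2 / (2 * t0)) / sqrt (2 * pi * T) \<le> heat a t x"
proof -
  define l where "l = exp (- (R + a)\<^sup>2 / (2 * t0)) / sqrt (2 * pi * T)"
  have pos: "0 < t" "0 < T" "0 \<le> l" using assms by (auto simp: l_def)
  have dens: "l \<le> normal_density 0 (sqrt t) (u - x)" if "u \<in> {-a..a}" for u
  proof -
    have "(u - x)\<^sup>2 \<le> (R + a)\<^sup>2"
      using that assms(1,5) by (intro abs_le_square_iff[THEN iffD1]) auto
    then have "(u - x)\<^sup>2 / (2 * t) \<le> (R + a)\<^sup>2 / (2 * t0)"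
      using assms by (intro frac_le) auto
    then have "l \<le> exp (- (u - x)\<^sup>2 / (2 * t)) / sqrt (2 * pi * t)"
      unfolding l_def using assms pos by (intro frac_le) auto
    then show ?thesis using pos by (simp add: normal_density_def)
  qed
  have "ennreal (2 * a * l) = (\<integral>\<^sup>+u. ennreal l * indicator {-a..a} u \<partial>lborel)"
    using assms(1) pos by (subst nn_integral_cmult_indicator) (auto simp: ennreal_mult[symmetric] mult.commute)
  also have "\<dots> \<le> (\<integral>\<^sup>+u. ennreal (normal_density 0 (sqrt t) (u - x)) * indicator {-a..a} u \<partial>lborel)"
    by (intro nn_integral_mono) (auto split: split_indicator intro!: ennreal_leI dens)
  also have "\<dots> = ennreal (heat a t x)"
    using pos by (simp add: ennreal_heat_translate)
  finally show ?thesis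
    by (simp add: l_def heat_nonneg)
qed

section \<open>Finiteness of the population at each time\<close>

primrec ancestors :: "particle \<Rightarrow> particle set" where
  "ancestors [] = {}"
| "ancestors (b # v) = insert v (ancestors v)"

lemma finite_ancestors [simp]: "finite (ancestors v)"
  by (induction v) auto

lemma length_ancestor: "u \<in> ancestors v \<Longrightarrow> length u < length v"
  by (induction v) auto

lemma not_self_ancestor [simp]: "v \<notin> ancestors v"
  using length_ancestor[of v v] by auto

lemma card_ancestors: "card (ancestors v) = length v"
  by (induction v) auto

text \<open>A sum over a set of distinct labels is the form to which the product formula for
  independent variables applies.\<close>

lemma birth_time_eq_sum: "birth_time \<tau> v \<omega> = (\<Sum>u\<in>ancestors v. \<tau> u \<omega>)"
  by (induction v) auto

text \<open>
  The lower bound of \<open>prob_lineage_hits_ge\<close> for \<open>T = sqrt k\<close> and \<open>h = 1 / T\<close>, uniformly in \<open>T / 2 \<le> t \<le> T\<close>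
  and \<open>\<bar>x\<bar> \<le> 6 * ln k\<close>; the number of generations \<open>m\<close> is taken so large that \<open>exp T / 2 ^ m\<close> is absorbed.
\<close>

definition hit_bound :: "real \<Rightarrow> nat \<Rightarrow> real" where
  "hit_bound a k = exp (- (1 / sqrt (real k))) *
     (2 * a * exp (- (6 * ln (real k) + a)\<^sup>2 / sqrt (real k)) / sqrt (2 * pi * sqrt (real k)))
     - 2 * (150000 / a ^ 4) / real k"

context branching_reflected_brownian_motion
begin

text \<open>Order 2 gives a factor \<open>1 / 3\<close> per ancestor, which beats the
  \<open>2 ^ n\<close> labels of generation \<open>n\<close>; order 1 would give exactly
  \<open>1 / 2\<close>.\<close>

lemma nn_integral_exp_birth_time:
  "(\<integral>\<^sup>+\<omega>. ennreal (exp (- 2 * birth_time \<tau> v \<omega>)) \<partial>M) = ennreal ((1 / 3) ^ length v)"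
proof -
  have "indep_vars (\<lambda>_. borel) (\<lambda>u \<omega>. ennreal (exp (- 2 * fst (noise \<tau> B u \<omega>)))) UNIV"
    by (rule indep_vars_compose2[OF indep_noise]) measurable
  then have "indep_vars (\<lambda>_. borel) (\<lambda>u \<omega>. ennreal (exp (- 2 * \<tau> u \<omega>))) UNIV"
    by (simp add: noise_def)
  from indep_vars_subset[OF this subset_UNIV[of "ancestors v"]] have "(\<integral>\<^sup>+\<omega>. (\<Prod>u\<in>ancestors v. ennreal (exp (- 2 * \<tau> u \<omega>))) \<partial>M)
      = (\<Prod>u\<in>ancestors v. \<integral>\<^sup>+\<omega>. ennreal (exp (- 2 * \<tau> u \<omega>)) \<partial>M)"
    by (intro indep_vars_nn_integral) auto
  also have "\<dots> = (\<Prod>u\<in>ancestors v. ennreal (1 / 3))"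
    using nn_integral_exp_lifetime[of "-2"] by (intro prod.cong) auto
  also have "\<dots> = ennreal ((1 / 3) ^ length v)"
    by (simp only: prod_constant card_ancestors) (rule ennreal_power, simp)
  also have "(\<lambda>\<omega>. \<Prod>u\<in>ancestors v. ennreal (exp (- 2 * \<tau> u \<omega>))) = (\<lambda>\<omega>. ennreal (exp (- 2 * birth_time \<tau> v \<omega>)))"
    by (simp add: fun_eq_iff prod_ennreal birth_time_eq_sum sum_distrib_left exp_sum)
  finally show ?thesis .
qed

lemma measurable_birth_time [measurable]: "random_variable borel (birth_time \<tau> v)"
  by (simp add: birth_time_eq_sum[abs_def])

text \<open>By Markov's inequality some label of length \<open>n\<close> is born by time
  \<open>N\<close> with probability at most \<open>exp (2 * N) * (2 / 3) ^ n\<close>, so almost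
  surely only finitely many generations have births by then. This is needed because
  \<open>Min\<close> is informative on finite sets only.\<close>

lemma AE_finite_born: "AE \<omega> in M. \<forall>t. finite {v. birth_time \<tau> v \<omega> \<le> t}"
proof -
  define L where "L n = {v :: particle. length v = n}" for n
  have L: "finite (L n)" "card (L n) = 2 ^ n" for n
    using finite_lists_length_eq[of "UNIV :: bool set" n] card_lists_length_eq[of "UNIV :: bool set" n]
    by (auto simp: L_def)
  have "AE \<omega> in M. finite {v. birth_time \<tau> v \<omega> \<le> real N}" for N
  proof -
    define A where "A n = (\<Union>v\<in>L n. {\<omega> \<in> space M. birth_time \<tau> v \<omega> \<le> real N})" for n
    have [measurable]: "A n \<in> events" for n
      unfolding A_def using L by (intro sets.finite_UN) auto
    have born: "prob {\<omega> \<in> space M. birth_time \<tau> v \<omega> \<le> real N} \<le> exp (2 * real N) * (1 / 3) ^ length v" for v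
    proof -
      have "emeasure M {\<omega> \<in> space M. birth_time \<tau> v \<omega> \<le> real N}
          = (\<integral>\<^sup>+\<omega>. indicator {\<omega> \<in> space M. birth_time \<tau> v \<omega> \<le> real N} \<omega> \<partial>M)" by simp
      also have "\<dots> \<le> (\<integral>\<^sup>+\<omega>. ennreal (exp (2 * real N)) * ennreal (exp (- 2 * birth_time \<tau> v \<omega>)) \<partial>M)"
        by (intro nn_integral_mono)
          (auto split: split_indicator simp flip: ennreal_mult exp_add ennreal_1 intro!: ennreal_leI)
      also have "\<dots> = ennreal (exp (2 * real N)) * ennreal ((1 / 3) ^ length v)"
        by (subst nn_integral_cmult) (auto simp only: nn_integral_exp_birth_time, measurable)
      finally show ?thesis
        unfolding emeasure_eq_measure by (subst (asm) ennreal_mult[symmetric]) auto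
    qed
    have bound: "prob (A n) \<le> exp (2 * real N) * (2 / 3) ^ n" for n
    proof -
      have "prob (A n) \<le> (\<Sum>v\<in>L n. prob {\<omega> \<in> space M. birth_time \<tau> v \<omega> \<le> real N})"
        unfolding A_def using L by (intro finite_measure_subadditive_finite) auto
      also have "\<dots> \<le> (\<Sum>v\<in>L n. exp (2 * real N) * (1 / 3) ^ n)"
        using born by (intro sum_mono) (auto simp: L_def)
      also have "\<dots> = exp (2 * real N) * (2 / 3) ^ n"
        by (simp add: L power_divide)
      finally show ?thesis .
    qed
    have geo: "summable (\<lambda>n. exp (2 * real N) * (2 / 3 :: real) ^ n)"
      by (intro summable_mult summable_geometric) auto
    have "summable (\<lambda>n. prob (A n))"
      by (rule summable_comparison_test'[OF geo]) (use bound in simp)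
    then have "AE \<omega> in M. \<forall>\<^sub>F n in sequentially. \<omega> \<in> space M - A n"
      by (intro borel_cantelli_AE1) (auto simp: less_top[symmetric])
    then show ?thesis
    proof (rule AE_mp, intro AE_I2 impI)
      fix \<omega> assume "\<forall>\<^sub>F n in sequentially. \<omega> \<in> space M - A n" "\<omega> \<in> space M"
      then obtain n0 where n0: "\<And>n. n0 \<le> n \<Longrightarrow> \<omega> \<notin> A n"
        by (auto simp: eventually_sequentially)
      have "{v. birth_time \<tau> v \<omega> \<le> real N} \<subseteq> (\<Union>n<n0. L n)"
      proof
        fix v assume "v \<in> {v. birth_time \<tau> v \<omega> \<le> real N}"
        then have "\<omega> \<in> A (length v)" using \<open>\<omega> \<in> space M\<close> by (auto simp: A_def L_def)
        then have "length v < n0" using n0 by (meson not_le)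
        then show "v \<in> (\<Union>n<n0. L n)" by (auto simp: L_def)
      qed
      then show "finite {v. birth_time \<tau> v \<omega> \<le> real N}"
        by (rule finite_subset) (simp add: L)
    qed
  qed
  then have "AE \<omega> in M. \<forall>N. finite {v. birth_time \<tau> v \<omega> \<le> real N}"
    by (subst AE_all_countable) simp
  then show ?thesis
  proof (rule AE_mp, intro AE_I2 impI allI)
    fix \<omega> t assume *: "\<forall>N. finite {v. birth_time \<tau> v \<omega> \<le> real N}"
    have "{v. birth_time \<tau> v \<omega> \<le> t} \<subseteq> {v. birth_time \<tau> v \<omega> \<le> real (nat \<lceil>t\<rceil>)}"
      by (auto intro: order_trans real_nat_ceiling_ge)
    with * show "finite {v. birth_time \<tau> v \<omega> \<le> t}" by (blast intro: finite_subset)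
  qed
qed

section \<open>Pathwise translation from noises to particles\<close>

definition regular :: "'a \<Rightarrow> bool" where
  "regular \<omega> \<longleftrightarrow> (\<forall>v. 0 < \<tau> v \<omega> \<and> continuous_on {0..} (\<lambda>s. B v s \<omega>))"

lemma AE_regular: "AE \<omega> in M. regular \<omega>"
  unfolding regular_def
  by (subst AE_all_countable) (use AE_lifetime_pos AE_motion_continuous in auto)

text \<open>The windows \<open>{sqrt k..sqrt k + 1 / sqrt k}\<close> of successive \<open>k\<close>
  overlap, so covering them for all large \<open>k\<close> controls every large time.\<close>

definition covered :: "real \<Rightarrow> real \<Rightarrow> real \<Rightarrow> 'a \<Rightarrow> bool" where
  "covered h e t \<omega> \<longleftrightarrow> (\<exists>v. \<forall>s\<in>{t..t + h}. v \<in> alive \<tau> s \<omega> \<and> position \<tau> B v s \<omega> \<le> e)"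

lemma displacement_noise:
  "regular \<omega> \<Longrightarrow> displacement (noise \<tau> B v \<omega>) = B v (\<tau> v \<omega>) \<omega>"
  unfolding displacement_def noise_def driving_path_def regular_def
  by (simp add: path_value_eq less_imp_le)

lemma hit_imp_covered:
  assumes reg: "regular \<omega>"
    and hit: "hit h e (t - birth_time \<tau> v \<omega>) (birth_place \<tau> B v \<omega>) (noise \<tau> B v \<omega>)"
  shows "covered h e t \<omega>"
proof -
  let ?r = "t - birth_time \<tau> v \<omega>" and ?x = "birth_place \<tau> B v \<omega>"
  have r: "0 \<le> ?r" "?r + h < \<tau> v \<omega>"
    and rat: "\<And>q. real_of_rat q \<in> {0..h} \<Longrightarrow> \<bar>?x + path_value (driving_path B v \<omega>) (?r + real_of_rat q)\<bar> \<le> e"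
    using hit by (auto simp: hit_def noise_def)
  have cont: "continuous_on {0..} (\<lambda>s. B v s \<omega>)" using reg by (simp add: regular_def)
  have bound: "\<bar>?x + B v (?r + q) \<omega>\<bar> \<le> e" if q: "0 \<le> q" "q \<le> h" for q
  proof -
    \<comment> \<open>\<open>hit\<close> tests rational ages only. The grid points
      \<open>g j\<close> are rational, lie in \<open>{0..q}\<close> and tend to \<open>q\<close>, so
      continuity carries the bound to real \<open>q\<close>.\<close>
    define g where "g j = real (nat \<lfloor>real (Suc j) * q\<rfloor>) / real (Suc j)" for j
    have lim: "g \<longlonglongrightarrow> q" unfolding g_def using q(1) by (rule floor_grid_tendsto)
    have g: "0 \<le> g j" "g j \<le> q" for j
    proof -
      show "0 \<le> g j" by (simp add: g_def)
      have "real (nat \<lfloor>real (Suc j) * q\<rfloor>) \<le> real (Suc j) * q" using q(1) by simp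
      then show "g j \<le> q" by (simp add: g_def divide_le_eq mult.commute)
    qed
    have "g j = real_of_rat (of_nat (nat \<lfloor>real (Suc j) * q\<rfloor>) / of_nat (Suc j))" for j
      unfolding g_def of_rat_divide by (simp del: of_nat_Suc)
    then have grid: "\<bar>?x + path_value (driving_path B v \<omega>) (?r + g j)\<bar> \<le> e" for j
      using rat g[of j] q by (metis atLeastAtMost_iff order_trans)
    have le: "\<bar>?x + B v (?r + g j) \<omega>\<bar> \<le> e" for j
      using grid[of j] path_value_eq[OF cont, of "?r + g j"] r g(1)[of j] unfolding driving_path_def by simp
    have "(\<lambda>j. B v (?r + g j) \<omega>) \<longlonglongrightarrow> B v (?r + q) \<omega>"
      using r q g lim by (intro continuous_on_tendsto_compose[OF cont] tendsto_intros) auto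
    then have "(\<lambda>j. \<bar>?x + B v (?r + g j) \<omega>\<bar>) \<longlonglongrightarrow> \<bar>?x + B v (?r + q) \<omega>\<bar>"
      by (intro tendsto_intros)
    then show ?thesis using le by (intro LIMSEQ_le_const2) auto
  qed
  have "v \<in> alive \<tau> s \<omega> \<and> position \<tau> B v s \<omega> \<le> e" if "s \<in> {t..t + h}" for s
    using that r bound[of "s - t"] by (auto simp: alive_def position_def algebra_simps)
  then show ?thesis unfolding covered_def by blast
qed

text \<open>Passing to a child updates remaining time and place exactly as \<open>birth_time\<close>
  and \<open>birth_place\<close> do, so the absolute target time stays \<open>t\<close>.\<close>

lemma lineage_hits_imp_covered:
  assumes reg: "regular \<omega>"
    and "lineage_hits h e m (t - birth_time \<tau> v \<omega>) (birth_place \<tau> B v \<omega>) v (configuration \<omega>)"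
  shows "covered h e t \<omega>"
  using assms(2)
proof (induction m arbitrary: v)
  case 0
  then show ?case using hit_imp_covered[OF reg] by simp
next
  case (Suc m)
  then show ?case
    using hit_imp_covered[OF reg] Suc.IH[of "True # v"]
    by (auto simp: displacement_noise[OF reg]) (simp add: noise_def diff_diff_eq)
qed

lemma not_all_miss_imp_covered:
  assumes reg: "regular \<omega>"
    and "\<not> all_miss h e m n (t - birth_time \<tau> v \<omega>) (birth_place \<tau> B v \<omega>) v (configuration \<omega>)"
  shows "covered h e t \<omega>"
  using assms(2)
proof (induction n arbitrary: v)
  case 0
  then show ?case using lineage_hits_imp_covered[OF reg] by simp
next
  case (Suc n)
  then show ?case
    using Suc.IH[of "True # v"] Suc.IH[of "False # v"]
    by (auto simp: displacement_noise[OF reg]) (simp_all add: noise_def diff_diff_eq)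
qed

text \<open>The second summand bounds the \<open>excess\<close> of the root for
  \<open>T0 = T / 2\<close> and \<open>R = 6 * ln k\<close>: its exponents are
  \<open>(T / 2 - T) / 2\<close> and \<open>- R / 2\<close>, and \<open>2 ^ n\<close> is at most
  \<open>k\<close>.\<close>

lemma miss_bound:
  assumes a: "0 < a" and k: "0 < k" and pos: "0 \<le> hit_bound a k"
  obtains m n where
    "prob {\<omega> \<in> space M. all_miss (1 / sqrt (real k)) (2 * a) m n (sqrt (real k)) 0 [] (configuration \<omega>)}
      \<le> exp (- hit_bound a k * real k / 2)
        + real k * (exp (- sqrt (real k) / 4) + 2 * exp (- 3 * ln (real k)))"
proof -
  define T where "T = sqrt (real k)"
  define h where "h = 1 / T"
  define K where "K = 150000 / a ^ 4"
  define p where "p = hit_bound a k"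
  have T: "0 < T" using k by (simp add: T_def)
  have h: "0 < h" "h\<^sup>2 = 1 / real k" using T k by (auto simp: h_def T_def power_divide)
  have K: "0 < K" using a by (simp add: K_def)
  \<comment> \<open>The truncation error is pushed below \<open>K / k\<close>, which also bounds the
    oscillation error; hence the factor 2 in \<open>hit_bound\<close>.\<close>
  obtain m where m: "exp T / (K / real k) < 2 ^ m"
    using real_arch_pow[of 2 "exp T / (K / real k)"] by auto
  then have m: "exp T / 2 ^ m \<le> K / real k"
    using K k by (simp add: field_simps)
  \<comment> \<open>Rounding down puts \<open>2 ^ n\<close> between \<open>k / 2\<close> and
    \<open>k\<close>: the lower bound serves the joint failure, the upper one the
    \<open>excess\<close>.\<close>
  define n where "n = nat \<lfloor>log 2 (real k)\<rfloor>"
  have n: "2 ^ n \<le> real k" "real k / 2 \<le> 2 ^ n"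
  proof -
    have l: "0 \<le> log 2 (real k)" using k by simp
    then have "real n \<le> log 2 (real k)" "log 2 (real k) - 1 \<le> real n" unfolding n_def by linarith+
    then have "2 powr real n \<le> 2 powr log 2 (real k)" "2 powr (log 2 (real k) - 1) \<le> 2 powr real n"
      by auto
    then show "2 ^ n \<le> real k" "real k / 2 \<le> 2 ^ n"
      using k by (auto simp: powr_realpow powr_diff)
  qed
  have hits: "p \<le> prob {\<omega> \<in> space M. lineage_hits h (2 * a) m t x v (configuration \<omega>)}"
    if t: "T / 2 \<le> t" "t \<le> T" and x: "\<bar>x\<bar> \<le> 6 * ln (real k)" for v t x
  proof -
    have "2 * a * exp (- (6 * ln (real k) + a)\<^sup>2 / (2 * (T / 2))) / sqrt (2 * pi * T) \<le> heat a t x"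
      using a T t x by (intro heat_ge) auto
    then have "exp (- h) * (2 * a * exp (- (6 * ln (real k) + a)\<^sup>2 / T) / sqrt (2 * pi * T)) \<le> exp (- h) * heat a t x"
      by (intro mult_left_mono) auto
    moreover have "exp (- h) * (K / real k) \<le> 1 * (K / real k)"
      using h K by (intro mult_right_mono) auto
    moreover have "exp t / 2 ^ m \<le> exp T / 2 ^ m"
      using t by (intro divide_right_mono) auto
    ultimately have "p \<le> exp (- h) * (heat a t x - K / real k) - exp t / 2 ^ m"
      using m unfolding p_def hit_bound_def K_def[symmetric] T_def[symmetric] h_def[symmetric]
      by (simp add: right_diff_distrib)
    also have "K / real k = 150000 * h\<^sup>2 / a ^ 4" by (simp add: h K_def)
    also have "exp (- h) * (heat a t x - 150000 * h\<^sup>2 / a ^ 4) - exp t / 2 ^ m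
        \<le> prob {\<omega> \<in> space M. lineage_hits h (2 * a) m t x v (configuration \<omega>)}"
      using h a t T by (intro prob_lineage_hits_ge) auto
    finally show ?thesis .
  qed
  have "1 \<le> real k" using k by simp
  \<comment> \<open>\<open>p\<close> is at most 1 because it bounds an actual probability from
    below, that of the lineage with \<open>t = T\<close> and \<open>x = 0\<close>.\<close>
  then have p: "0 \<le> p" "p \<le> 1"
    using pos T hits[of T 0 "[]"] prob_le_1 by (auto simp: p_def intro: order_trans)
  let ?E = "excess (T / 2) (6 * ln (real k)) n T 0"
  have "prob {\<omega> \<in> space M. all_miss h (2 * a) m n T 0 [] (configuration \<omega>)}
      \<le> (1 - p) ^ 2 ^ n + (1 - (1 - p) ^ 2 ^ n) * min 1 ?E"
    using p hits by (rule prob_all_miss_le) auto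
  also have "\<dots> \<le> exp (- p * real k / 2) + 1 * ?E"
  proof (intro add_mono mult_mono)
    have "(1 - p) ^ 2 ^ n \<le> exp (- p) ^ 2 ^ n"
      using p exp_ge_add_one_self[of "- p"] by (intro power_mono) auto
    also have "\<dots> = exp (- (p * 2 ^ n))" by (simp flip: exp_of_nat_mult add: mult.commute)
    also have "\<dots> \<le> exp (- p * real k / 2)"
      using n(2) mult_left_mono[OF n(2) p(1)] by simp
    finally show "(1 - p) ^ 2 ^ n \<le> exp (- p * real k / 2)" .
  qed (use p in \<open>auto simp: excess_nonneg power_le_one\<close>)
  also have "?E \<le> real k * (exp (- T / 4) + 2 * exp (- 3 * ln (real k)))"
    unfolding excess_def using n(1) by (intro mult_mono) (auto simp: add_nonneg_nonneg)
  finally show thesis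
    using that[of m n] by (simp add: p_def T_def h_def)
qed

text \<open>In \<open>hit_bound\<close> the term of order \<open>k powr (- 1 / 4)\<close> dominates
  the subtracted one of order \<open>1 / k\<close>. It is thus eventually nonnegative, and
  multiplied by \<open>k\<close> it grows like \<open>k powr (3 / 4)\<close>, which makes the joint
  failure smaller than any power of \<open>1 / k\<close>.\<close>

lemma AE_eventually_covered:
  assumes a: "0 < a"
  shows "AE \<omega> in M. \<forall>\<^sub>F k in sequentially. covered (1 / sqrt (real k)) (2 * a) (sqrt (real k)) \<omega>"
proof -
  define bnd where "bnd k = exp (- hit_bound a k * real k / 2)
      + real k * (exp (- sqrt (real k) / 4) + 2 * exp (- 3 * ln (real k)))" for k :: nat
  have K: "0 < 150000 / a ^ 4" using a by simp
  have ev: "\<forall>\<^sub>F k in sequentially. 0 < k \<and> 0 \<le> hit_bound a k"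
    unfolding hit_bound_def using a K by (intro eventually_conj eventually_gt_at_top) real_asymp
  have "\<forall>k. \<exists>m n. 0 < k \<and> 0 \<le> hit_bound a k \<longrightarrow>
    prob {\<omega> \<in> space M. all_miss (1 / sqrt (real k)) (2 * a) m n (sqrt (real k)) 0 [] (configuration \<omega>)} \<le> bnd k"
  proof
    fix k
    show "\<exists>m n. 0 < k \<and> 0 \<le> hit_bound a k \<longrightarrow>
      prob {\<omega> \<in> space M. all_miss (1 / sqrt (real k)) (2 * a) m n (sqrt (real k)) 0 [] (configuration \<omega>)} \<le> bnd k"
    proof (cases "0 < k \<and> 0 \<le> hit_bound a k")
      case True
      then obtain m n where "prob {\<omega> \<in> space M. all_miss (1 / sqrt (real k)) (2 * a) m n (sqrt (real k)) 0 [] (configuration \<omega>)} \<le> bnd k"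
        unfolding bnd_def using miss_bound[OF a, of k] by blast
      then show ?thesis by blast
    qed blast
  qed
  then obtain m where "\<forall>k. \<exists>n. 0 < k \<and> 0 \<le> hit_bound a k \<longrightarrow>
    prob {\<omega> \<in> space M. all_miss (1 / sqrt (real k)) (2 * a) (m k) n (sqrt (real k)) 0 [] (configuration \<omega>)} \<le> bnd k"
    by - (drule choice, erule exE, blast)
  then obtain n where "\<forall>k. 0 < k \<and> 0 \<le> hit_bound a k \<longrightarrow>
    prob {\<omega> \<in> space M. all_miss (1 / sqrt (real k)) (2 * a) (m k) (n k) (sqrt (real k)) 0 [] (configuration \<omega>)} \<le> bnd k"
    by - (drule choice, erule exE, blast)
  then have mn: "\<And>k. 0 < k \<Longrightarrow> 0 \<le> hit_bound a k \<Longrightarrow>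
    prob {\<omega> \<in> space M. all_miss (1 / sqrt (real k)) (2 * a) (m k) (n k) (sqrt (real k)) 0 [] (configuration \<omega>)} \<le> bnd k"
    by blast
  define A where "A k = {\<omega> \<in> space M. all_miss (1 / sqrt (real k)) (2 * a) (m k) (n k) (sqrt (real k)) 0 [] (configuration \<omega>)}" for k
  have [measurable]: "A k \<in> events" for k
  proof -
    have [measurable]: "Measurable.pred M (\<lambda>\<omega>. all_miss (1 / sqrt (real k)) (2 * a) (m k) (n k) (sqrt (real k)) 0 [] (configuration \<omega>))"
      by (rule measurable_all_miss[where D = UNIV]) auto
    show ?thesis unfolding A_def by measurable
  qed
  have "(\<lambda>k. exp (- hit_bound a k * real k / 2)) \<in> O(\<lambda>k. 1 / real k ^ 2)"
    unfolding hit_bound_def using a K by real_asymp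
  moreover have "(\<lambda>k. real k * (exp (- sqrt (real k) / 4) + 2 * exp (- 3 * ln (real k)))) \<in> O(\<lambda>k. 1 / real k ^ 2)"
    by real_asymp
  ultimately have "bnd \<in> O(\<lambda>k. 1 / real k ^ 2)"
    unfolding bnd_def[abs_def] by (rule sum_in_bigo)
  moreover have "summable (\<lambda>k. norm (1 / real k ^ 2))"
    using inverse_power_summable[of 2, where ?'a = real] by (simp add: inverse_eq_divide)
  ultimately have "summable bnd"
    by (rule summable_comparison_test_bigo[rotated])
  then have "summable (\<lambda>k. prob (A k))"
    by (rule summable_comparison_test_ev[rotated]) (use ev in eventually_elim, auto simp: A_def mn)
  then have "AE \<omega> in M. \<forall>\<^sub>F k in sequentially. \<omega> \<in> space M - A k"
    by (intro borel_cantelli_AE1) (auto simp: less_top[symmetric])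
  with AE_regular show ?thesis
  proof eventually_elim
    case (elim \<omega>)
    show ?case using elim(2)
    proof eventually_elim
      case (elim k)
      then show ?case
        by (intro not_all_miss_imp_covered[OF \<open>regular \<omega>\<close>, where v = "[]"]) (auto simp: A_def)
    qed
  qed
qed

lemma eventually_displacement_le:
  assumes born: "\<forall>t. finite {v. birth_time \<tau> v \<omega> \<le> t}"
    and cov: "\<forall>\<^sub>F k in sequentially. covered (1 / sqrt (real k)) e (sqrt (real k)) \<omega>"
  shows "\<forall>\<^sub>F t in at_top. minimal_displacement \<tau> B t \<omega> \<in> {0..e}"
proof -
  obtain N where N: "\<And>k. N \<le> k \<Longrightarrow> covered (1 / sqrt (real k)) e (sqrt (real k)) \<omega>"
    using cov by (auto simp: eventually_sequentially)
  have "minimal_displacement \<tau> B t \<omega> \<in> {0..e}" if t: "1 + real N \<le> t" for t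
  proof -
    \<comment> \<open>The last \<open>k\<close> with \<open>sqrt k\<close> at most \<open>t\<close>.
      Its window reaches \<open>t\<close> because \<open>sqrt k + 1 / sqrt k\<close> has square
      \<open>k + 2 + 1 / k\<close>, more than \<open>k + 1\<close>. The 1 in the threshold for
      \<open>t\<close> makes \<open>k\<close> positive even if \<open>N = 0\<close>.\<close>
    define k where "k = nat \<lfloor>t\<^sup>2\<rfloor>"
    have k: "real k \<le> t\<^sup>2" "t\<^sup>2 < real k + 1" 
      unfolding k_def using zero_le_power2[of t] by linarith+
    have "1 * (1 + real N) \<le> t * t" using t by (intro mult_mono) auto
    then have "1 + N \<le> k" unfolding k_def by (simp add: power2_eq_square le_nat_floor)
    then have kN: "N \<le> k" "0 < real k" by auto
    have "sqrt (real k) \<le> t" using k(1) t by (intro real_le_lsqrt) auto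
    moreover have "t \<le> sqrt (real k) + 1 / sqrt (real k)"
    proof (rule power2_le_imp_le)
      have "(sqrt (real k) + 1 / sqrt (real k))\<^sup>2 = real k + 2 + 1 / real k"
        using kN by (simp add: power2_sum power_divide)
      then show "t\<^sup>2 \<le> (sqrt (real k) + 1 / sqrt (real k))\<^sup>2" 
        using k(2) zero_le_divide_1_iff[of "real k"] kN(2) by linarith
    qed simp
    ultimately obtain v where v: "v \<in> alive \<tau> t \<omega>" "position \<tau> B v t \<omega> \<le> e"
      using N[OF kN(1)] unfolding covered_def by (meson atLeastAtMost_iff)
    have fin: "finite (alive \<tau> t \<omega>)"
      by (rule finite_subset[OF _ born[rule_format, of t]]) (auto simp: alive_def)
    have "minimal_displacement \<tau> B t \<omega> \<le> position \<tau> B v t \<omega>"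
      unfolding minimal_displacement_def using v fin by (intro Min_le) auto
    moreover have "minimal_displacement \<tau> B t \<omega> \<in> (\<lambda>v. position \<tau> B v t \<omega>) ` alive \<tau> t \<omega>"
      unfolding minimal_displacement_def using v fin by (intro Min_in) auto
    then have "0 \<le> minimal_displacement \<tau> B t \<omega>" by (auto simp: position_def)
    ultimately show ?thesis using v by simp
  qed
  then show ?thesis unfolding eventually_at_top_linorder by blast
qed

text \<open>Restricting to the radii \<open>2 / Suc j\<close> leaves countably many exceptional null
  sets to unite.\<close>

lemma AE_minimal_displacement_tendsto_0:
  "AE \<omega> in M. ((\<lambda>t. minimal_displacement \<tau> B t \<omega>) \<longlongrightarrow> 0) at_top"
proof -
  have "AE \<omega> in M. \<forall>j. \<forall>\<^sub>F k in sequentially.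
      covered (1 / sqrt (real k)) (2 * (1 / real (Suc j))) (sqrt (real k)) \<omega>"
    by (subst AE_all_countable) (intro allI AE_eventually_covered, simp)
  with AE_finite_born show ?thesis
  proof eventually_elim
    case (elim \<omega>)
    show ?case
    proof (rule tendstoI)
      fix r :: real assume "0 < r"
      then obtain j where j: "1 / real (Suc j) < r / 2"
        using nat_approx_posE[of "r / 2"] by auto
      from eventually_displacement_le[OF elim(1) elim(2)[rule_format, of j]]
      show "\<forall>\<^sub>F t in at_top. dist (minimal_displacement \<tau> B t \<omega>) 0 < r"
        by eventually_elim (use j in auto)
    qed
  qed
qed

end

theorem proposition1p4:
  fixes M :: "'a measure"
    and \<tau> :: "particle \<Rightarrow> 'a \<Rightarrow> real"
    and B :: "particle \<Rightarrow> real \<Rightarrow> 'a \<Rightarrow> real"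
  assumes "branching_reflected_brownian_motion M \<tau> B"
  shows "AE \<omega> in M. ((\<lambda>t. minimal_displacement \<tau> B t \<omega>) \<longlongrightarrow> 0) at_top"
  using branching_reflected_brownian_motion.AE_minimal_displacement_tendsto_0[OF assms] .

end
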